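(* Let $(\mathfrak A[\|\cdot\|_{\mathfrak A}],\mathfrak A_0)$ and $(\mathfrak B[\|\cdot\|_{\mathfrak B}],\mathfrak B_0)$ be (unital) Banach quasi *-algebras and let $\bar n$ be a uniform cross-norm on $\mathfrak A\otimes\mathfrak B$. Consider the statements: (1) $(\mathfrak A\otimes_{\bar n}\mathfrak B,\mathfrak A_0\otimes\mathfrak B_0)$ is *-semisimple; (2) $(\mathfrak A[\|\cdot\|_{\mathfrak A}],\mathfrak A_0)$ and $(\mathfrak B[\|\cdot\|_{\mathfrak B}],\mathfrak B_0)$ are *-semisimple. Then (1) implies (2); and if the normed space $\mathfrak A\otimes_{\bar n}\mathfrak B$ is barrelled, then (2) implies (1).
   Context: All vector spaces are complex. A quasi *-algebra $(\mathfrak A,\mathfrak A_0)$ is a vector space $\mathfrak A$ with a *-algebra $\mathfrak A_0\subseteq\mathfrak A$ (as a subspace) such that: (i) products $ax$, $xa$ ($a\in\mathfrak A$, $x\in\mathfrak A_0$) are defined in $\mathfrak A$ and bilinear, extending the multiplication of $\mathfrak A_0$; (ii) $(xa)y=x(ay)$, $a(xy)=(ax)y$ for $x,y\in\mathfrak A_0$, $a\in\mathfrak A$; (iii) $\mathfrak A$ has an involution extending that of $\mathfrak A_0$ with $(ax)^*=x^*a^*$, $(xa)^*=a^*x^*$. It is unital if there is $e\in\mathfrak A_0$ with $ae=a=ea$ for all $a\in\mathfrak A$. It is a normed (Banach) quasi *-algebra if $\mathfrak A$ carries a (complete) norm with $\|a^*\|=\|a\|$, $\mathfrak A_0$ dense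 in $\mathfrak A$, and $a\mapsto ax$ continuous for every $x\in\mathfrak A_0$. Standing convention: quasi *-algebras are unital, with units of norm $1$. $\mathfrak A\otimes\mathfrak B$ is a quasi *-algebra over $\mathfrak A_0\otimes\mathfrak B_0$ via $(a\otimes b)(x\otimes y)=ax\otimes by$, $(x\otimes y)(a\otimes b)=xa\otimes yb$, $(a\otimes b)^*=a^*\otimes b^*$. A cross-norm $\bar n$ on $\mathfrak A\otimes\mathfrak B$ is a norm with $\|a\otimes b\|_{\bar n}=\|a\|_{\mathfrak A}\|b\|_{\mathfrak B}$; it is uniform if for all bounded linear $T_1:\mathfrak A\to\mathfrak A$, $T_2:\mathfrak B\to\mathfrak B$ the operator $T_1\otimes T_2$ is $\bar n$-bounded and its extension to the completion has norm $\le\|T_1\|\|T_2\|$. $\mathfrak A\otimes_{\bar n}\mathfrak B$ denotes $\mathfrak A\otimes\mathfrak B$ with the norm $\bar n$; it is understood that the involution is $\bar n$-isometric, so that it is a normed quasi *-algebra over $\mathfrak A_0\otimes\mathfrak B_0$. For a normed quasi *-algebra $(\mathfrak A,\mathfrak A_0)$, $\mathcal S_{\mathfrak A_0}(\mathfrak A)$ is the set of sesquilinear forms $\Omega:\mathfrak A\times\mathfrak A\to\mathbb C$ such that $\Omega(a,a)\ge0$ for all $a\in\mathfrak A$; $\Omega(ax,y)=\Omega(x,a^*y)$ for all $a\in\mathfrak A$, $x,y\in\mathfrak A_0$; and $|\Omega(a,b)|\le\|a\|\|b\|$ for all $a,b\in\mathfrak A$. $(\mathfrak A,\mathfrak A_0)$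 is *-semisimple if for every $0\ne a\in\mathfrak A$ there is $\Omega\in\mathcal S_{\mathfrak A_0}(\mathfrak A)$ with $\Omega(a,a)>0$. *)

theory Defs
  imports "HOL-Analysis.Analysis" "HOL-Library.Poly_Mapping" "HOL-Library.Complex_Order"
begin

section \<open>Complex vector spaces\<close>

class scaleC = scaleR +
  fixes scaleC :: "complex \<Rightarrow> 'a \<Rightarrow> 'a" (infixr \<open>*\<^sub>C\<close> 75)

text \<open>The real structure is the restriction of the complex one, so that the library's
  notions for real vector spaces (such as \<open>convex\<close>) apply.\<close>

class complex_vector = ab_group_add + scaleC +
  assumes scaleR_scaleC: "scaleR r x = scaleC (complex_of_real r) x"
    and scaleC_add_right: "scaleC c (x + y) = scaleC c x + scaleC c y"
    and scaleC_add_left: "scaleC (c + d) x = scaleC c x + scaleC d x"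
    and scaleC_scaleC: "scaleC c (scaleC d x) = scaleC (c * d) x"
    and scaleC_one: "scaleC 1 x = x"

subclass (in complex_vector) real_vector
  by standard
    (simp_all add: scaleR_scaleC scaleC_add_right scaleC_add_left scaleC_scaleC scaleC_one)

global_interpretation complex_vector: vector_space "scaleC :: complex \<Rightarrow> 'a \<Rightarrow> 'a::complex_vector"
  by standard (simp_all add: scaleC_add_right scaleC_add_left scaleC_scaleC scaleC_one)

abbreviation clinear :: "('a::complex_vector \<Rightarrow> 'b::complex_vector) \<Rightarrow> bool" where
  "clinear \<equiv> Vector_Spaces.linear scaleC scaleC"

definition cbilinear :: "('a::complex_vector \<Rightarrow> 'b::complex_vector \<Rightarrow> 'c::complex_vector) \<Rightarrow> bool" where
  "cbilinear f \<longleftrightarrow> (\<forall>b. clinear (\<lambda>a. f a b)) \<and> (\<forall>a. clinear (f a))"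


section \<open>The algebraic tensor product\<close>

text \<open>The free complex vector space on a set consists of the finitely supported functions.\<close>

abbreviation free_scale :: "complex \<Rightarrow> ('x \<Rightarrow>\<^sub>0 complex) \<Rightarrow> ('x \<Rightarrow>\<^sub>0 complex)" where
  "free_scale c \<equiv> Poly_Mapping.map ((*) c)"

lemma lookup_free_scale [simp]:
  "Poly_Mapping.lookup (free_scale c p) k = c * Poly_Mapping.lookup p k"
  by (simp add: map.rep_eq when_def)

global_interpretation free_vector: vector_space free_scale
  by standard (auto intro!: poly_mapping_eqI simp: lookup_add algebra_simps)

abbreviation free_basis :: "'a \<Rightarrow> 'b \<Rightarrow> ('a \<times> 'b) \<Rightarrow>\<^sub>0 complex" where
  "free_basis a b \<equiv> Poly_Mapping.single (a, b) 1"

definition tensor_relations :: "(('a::complex_vector \<times> 'b::complex_vector) \<Rightarrow>\<^sub>0 complex) set" where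
  "tensor_relations =
     {free_basis (a + a') b - free_basis a b - free_basis a' b | a a' b. True} \<union>
     {free_basis a (b + b') - free_basis a b - free_basis a b' | a b b'. True} \<union>
     {free_basis (c *\<^sub>C a) b - free_scale c (free_basis a b) | c a b. True} \<union>
     {free_basis a (c *\<^sub>C b) - free_scale c (free_basis a b) | c a b. True}"

quotient_type (overloaded) ('a, 'b) tensor = "('a::complex_vector \<times> 'b::complex_vector) \<Rightarrow>\<^sub>0 complex" /
  "\<lambda>p q. p - q \<in> free_vector.span tensor_relations"
proof (rule equivpI)
  let ?S = "free_vector.span (tensor_relations :: (('a \<times> 'b) \<Rightarrow>\<^sub>0 complex) set)"
  show "reflp (\<lambda>p q. p - q \<in> ?S)"
    by (simp add: reflp_def free_vector.span_zero)
  show "symp (\<lambda>p q. p - q \<in> ?S)"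
    by (metis (mono_tags, lifting) sympI free_vector.span_neg minus_diff_eq)
  show "transp (\<lambda>p q. p - q \<in> ?S)"
  proof (rule transpI)
    fix p q r assume "p - q \<in> ?S" "q - r \<in> ?S"
    then have "(p - q) + (q - r) \<in> ?S" by (rule free_vector.span_add)
    then show "p - r \<in> ?S" by simp
  qed
qed

instantiation tensor :: (complex_vector, complex_vector) complex_vector
begin

lift_definition zero_tensor :: "('a, 'b) tensor" is 0 .

lift_definition plus_tensor :: "('a, 'b) tensor \<Rightarrow> ('a, 'b) tensor \<Rightarrow> ('a, 'b) tensor" is "(+)"
proof -
  fix p p' q q' :: "('a \<times> 'b) \<Rightarrow>\<^sub>0 complex"
  let ?S = "free_vector.span (tensor_relations :: (('a \<times> 'b) \<Rightarrow>\<^sub>0 complex) set)"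
  assume "p - p' \<in> ?S" "q - q' \<in> ?S"
  then have "(p - p') + (q - q') \<in> ?S" by (rule free_vector.span_add)
  then show "p + q - (p' + q') \<in> ?S" by (simp add: algebra_simps)
qed

lift_definition minus_tensor :: "('a, 'b) tensor \<Rightarrow> ('a, 'b) tensor \<Rightarrow> ('a, 'b) tensor" is "(-)"
proof -
  fix p p' q q' :: "('a \<times> 'b) \<Rightarrow>\<^sub>0 complex"
  let ?S = "free_vector.span (tensor_relations :: (('a \<times> 'b) \<Rightarrow>\<^sub>0 complex) set)"
  assume "p - p' \<in> ?S" "q - q' \<in> ?S"
  then have "(p - p') - (q - q') \<in> ?S" by (rule free_vector.span_diff)
  then show "p - q - (p' - q') \<in> ?S" by (simp add: algebra_simps)
qed

lift_definition uminus_tensor :: "('a, 'b) tensor \<Rightarrow> ('a, 'b) tensor" is uminus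
  by (metis free_vector.span_neg minus_diff_minus)

lift_definition scaleC_tensor :: "complex \<Rightarrow> ('a, 'b) tensor \<Rightarrow> ('a, 'b) tensor" is free_scale
  by (metis free_vector.scale_right_diff_distrib free_vector.span_scale)

lift_definition scaleR_tensor :: "real \<Rightarrow> ('a, 'b) tensor \<Rightarrow> ('a, 'b) tensor"
  is "\<lambda>r. free_scale (complex_of_real r)"
  by (metis free_vector.scale_right_diff_distrib free_vector.span_scale)

instance
proof
  fix u v w :: "('a, 'b) tensor" and c d :: complex and r :: real
  show "u + v + w = u + (v + w)"
    by transfer (simp add: add.assoc free_vector.span_zero)
  show "u + v = v + u"
    by transfer (simp add: add.commute free_vector.span_zero)
  show "0 + u = u"
    by transfer (simp add: free_vector.span_zero)
  show "- u + u = 0"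
    by transfer (simp add: free_vector.span_zero)
  show "u - v = u + - v"
    by transfer (simp add: free_vector.span_zero)
  show "r *\<^sub>R u = complex_of_real r *\<^sub>C u"
    by transfer (simp add: free_vector.span_zero)
  show "c *\<^sub>C (u + v) = c *\<^sub>C u + c *\<^sub>C v"
    by transfer (simp add: free_vector.span_zero free_vector.scale_right_distrib)
  show "(c + d) *\<^sub>C u = c *\<^sub>C u + d *\<^sub>C u"
    by transfer (simp add: free_vector.span_zero free_vector.scale_left_distrib)
  show "c *\<^sub>C d *\<^sub>C u = (c * d) *\<^sub>C u"
    by transfer (simp add: free_vector.span_zero)
  show "1 *\<^sub>C u = u"
    by transfer (simp add: free_vector.span_zero)
qed

end

lift_definition tensor :: "'a::complex_vector \<Rightarrow> 'b::complex_vector \<Rightarrow> ('a, 'b) tensor" (infixr \<open>\<otimes>\<close> 71)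
  is free_basis .

text \<open>\<open>tensor_rep S T u\<close> encodes a representation of \<open>u\<close> as a linear combination of
  elementary tensors \<open>a \<otimes> b\<close> with \<open>a \<in> S\<close> and \<open>b \<in> T\<close>, where one exists.
  The operations defined below do not depend on its choice: they satisfy
  \<open>tensor_map_tensor\<close>, \<open>tensor_star_tensor\<close>, \<open>tensor_mult_tensor_right\<close> and
  \<open>tensor_mult_tensor_left\<close>, and make the tensor product a quasi *-algebra; see
  \<open>tensor_quasi_star_algebra\<close>.\<close>

definition tensor_rep ::
  "'a set \<Rightarrow> 'b set \<Rightarrow> ('a::complex_vector, 'b::complex_vector) tensor \<Rightarrow> ('a \<times> 'b) \<Rightarrow>\<^sub>0 complex" where
  "tensor_rep S T u = (SOME p. Poly_Mapping.keys p \<subseteq> S \<times> T \<and> abs_tensor p = u)"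

definition tensor_map ::
  "('a::complex_vector \<Rightarrow> 'c::complex_vector) \<Rightarrow> ('b::complex_vector \<Rightarrow> 'd::complex_vector) \<Rightarrow>
   ('a, 'b) tensor \<Rightarrow> ('c, 'd) tensor" where
  "tensor_map T\<^sub>1 T\<^sub>2 u =
     (let p = tensor_rep UNIV UNIV u in
      \<Sum>(a, b)\<in>Poly_Mapping.keys p. Poly_Mapping.lookup p (a, b) *\<^sub>C (T\<^sub>1 a \<otimes> T\<^sub>2 b))"

definition tensor_star ::
  "('a::complex_vector \<Rightarrow> 'a) \<Rightarrow> ('b::complex_vector \<Rightarrow> 'b) \<Rightarrow> ('a, 'b) tensor \<Rightarrow> ('a, 'b) tensor" where
  "tensor_star starA starB u =
     (let p = tensor_rep UNIV UNIV u in
      \<Sum>(a, b)\<in>Poly_Mapping.keys p. cnj (Poly_Mapping.lookup p (a, b)) *\<^sub>C (starA a \<otimes> starB b))"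

text \<open>The subspace spanned by the elementary tensors over two subspaces; it is (a copy of)
  their tensor product.\<close>

definition tensor_subspace ::
  "'a::complex_vector set \<Rightarrow> 'b::complex_vector set \<Rightarrow> ('a, 'b) tensor set" where
  "tensor_subspace S T = complex_vector.span {x \<otimes> y | x y. x \<in> S \<and> y \<in> T}"

text \<open>The product of a quasi *-algebra is only meaningful if one of the factors is in the
  distinguished *-algebra; that factor has to be represented there.\<close>

definition tensor_mult ::
  "'a::complex_vector set \<Rightarrow> ('a \<Rightarrow> 'a \<Rightarrow> 'a) \<Rightarrow> 'b::complex_vector set \<Rightarrow> ('b \<Rightarrow> 'b \<Rightarrow> 'b) \<Rightarrow>
   ('a, 'b) tensor \<Rightarrow> ('a, 'b) tensor \<Rightarrow> ('a, 'b) tensor" where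
  "tensor_mult A\<^sub>0 multA B\<^sub>0 multB u w =
     (let (p, q) = (if w \<in> tensor_subspace A\<^sub>0 B\<^sub>0
                    then (tensor_rep UNIV UNIV u, tensor_rep A\<^sub>0 B\<^sub>0 w)
                    else (tensor_rep A\<^sub>0 B\<^sub>0 u, tensor_rep UNIV UNIV w)) in
      \<Sum>(a, b)\<in>Poly_Mapping.keys p. \<Sum>(x, y)\<in>Poly_Mapping.keys q.
        (Poly_Mapping.lookup p (a, b) * Poly_Mapping.lookup q (x, y)) *\<^sub>C (multA a x \<otimes> multB b y))"


section \<open>Norms\<close>

text \<open>A tensor product carries many norms, so norms are explicit functions here.\<close>

locale complex_norm =
  fixes N :: "'a::complex_vector \<Rightarrow> real"
  assumes norm_eq_zero_iff: "N a = 0 \<longleftrightarrow> a = 0"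
    and norm_triangle: "N (a + b) \<le> N a + N b"
    and norm_scale: "N (c *\<^sub>C a) = cmod c * N a"

abbreviation norm_dist :: "('a::complex_vector \<Rightarrow> real) \<Rightarrow> 'a \<Rightarrow> 'a \<Rightarrow> real" where
  "norm_dist N \<equiv> \<lambda>a b. N (a - b)"

abbreviation norm_topology :: "('a::complex_vector \<Rightarrow> real) \<Rightarrow> 'a topology" where
  "norm_topology N \<equiv> Metric_space.mtopology UNIV (norm_dist N)"

abbreviation norm_Cauchy :: "('a::complex_vector \<Rightarrow> real) \<Rightarrow> (nat \<Rightarrow> 'a) \<Rightarrow> bool" where
  "norm_Cauchy N \<equiv> Metric_space.MCauchy UNIV (norm_dist N)"

abbreviation norm_complete :: "('a::complex_vector \<Rightarrow> real) \<Rightarrow> bool" where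
  "norm_complete N \<equiv> Metric_space.mcomplete UNIV (norm_dist N)"

lemma (in complex_norm) Metric_space_norm_dist: "Metric_space UNIV (norm_dist N)"
proof
  have sym: "N (a - b) = N (b - a)" for a b
    using norm_scale[of "-1" "a - b"] by simp
  show "N (a - b) = N (b - a)" for a b by (rule sym)
  show "N (a - b) = 0 \<longleftrightarrow> a = b" for a b by (simp add: norm_eq_zero_iff)
  show "N (a - c) \<le> N (a - b) + N (b - c)" for a b c
    using norm_triangle[of "a - b" "b - c"] by simp
  show "0 \<le> N (a - b)" for a b
    using norm_triangle[of "a - b" "b - a"] norm_eq_zero_iff[of 0] sym[of a b] by simp
qed

definition bounded_operator :: "('a::complex_vector \<Rightarrow> real) \<Rightarrow> ('a \<Rightarrow> 'a) \<Rightarrow> bool" where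
  "bounded_operator N T \<longleftrightarrow> clinear T \<and> (\<exists>C. \<forall>a. N (T a) \<le> C * N a)"

definition operator_norm :: "('a::complex_vector \<Rightarrow> real) \<Rightarrow> ('a \<Rightarrow> 'a) \<Rightarrow> real" where
  "operator_norm N T = (SUP a. N (T a) / N a)"

text \<open>The norm of the continuous extension of a bounded operator to the completion: the elements of
  the completion are the classes \<open>[u]\<close> of \<open>N\<close>-Cauchy sequences \<open>u\<close>, normed by
  \<open>lim (\<lambda>k. N (u k))\<close>, and the extension of \<open>T\<close> maps \<open>[u]\<close> to \<open>[T \<circ> u]\<close>.\<close>

definition extension_norm :: "('a::complex_vector \<Rightarrow> real) \<Rightarrow> ('a \<Rightarrow> 'a) \<Rightarrow> real" where
  "extension_norm N T =
     (SUP u\<in>{u. norm_Cauchy N u}. lim (\<lambda>k. N (T (u k))) / lim (\<lambda>k. N (u k)))"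

definition barrel :: "('a::complex_vector \<Rightarrow> real) \<Rightarrow> 'a set \<Rightarrow> bool" where
  "barrel N V \<longleftrightarrow>
     closedin (norm_topology N) V \<and> convex V \<and>
     (\<forall>c a. cmod c \<le> 1 \<longrightarrow> a \<in> V \<longrightarrow> c *\<^sub>C a \<in> V) \<and>
     (\<forall>a. \<exists>r>0. \<forall>c. cmod c \<le> r \<longrightarrow> c *\<^sub>C a \<in> V)"

definition barrelled :: "('a::complex_vector \<Rightarrow> real) \<Rightarrow> bool" where
  "barrelled N \<longleftrightarrow> (\<forall>V. barrel N V \<longrightarrow> 0 \<in> norm_topology N interior_of V)"

definition cross_norm ::
  "('a::complex_vector \<Rightarrow> real) \<Rightarrow> ('b::complex_vector \<Rightarrow> real) \<Rightarrow> (('a, 'b) tensor \<Rightarrow> real) \<Rightarrow> bool" where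
  "cross_norm NA NB n \<longleftrightarrow> complex_norm n \<and> (\<forall>a b. n (a \<otimes> b) = NA a * NB b)"

definition uniform_cross_norm ::
  "('a::complex_vector \<Rightarrow> real) \<Rightarrow> ('b::complex_vector \<Rightarrow> real) \<Rightarrow> (('a, 'b) tensor \<Rightarrow> real) \<Rightarrow> bool" where
  "uniform_cross_norm NA NB n \<longleftrightarrow> cross_norm NA NB n \<and>
     (\<forall>T\<^sub>1 T\<^sub>2. bounded_operator NA T\<^sub>1 \<longrightarrow> bounded_operator NB T\<^sub>2 \<longrightarrow>
        bounded_operator n (tensor_map T\<^sub>1 T\<^sub>2) \<and>
        extension_norm n (tensor_map T\<^sub>1 T\<^sub>2) \<le> operator_norm NA T\<^sub>1 * operator_norm NB T\<^sub>2)"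


section \<open>Quasi *-algebras\<close>

text \<open>The products \<open>a \<cdot> x\<close> and \<open>x \<cdot> a\<close> both extend the product of \<open>A\<^sub>0\<close>, so they agree where both
  are defined and are given by one function. Its values at pairs with neither component in
  \<open>A\<^sub>0\<close> are irrelevant.\<close>

locale quasi_star_algebra =
  fixes A\<^sub>0 :: "'a::complex_vector set"
    and mul :: "'a \<Rightarrow> 'a \<Rightarrow> 'a" (infixl \<open>\<cdot>\<close> 70)
    and star :: "'a \<Rightarrow> 'a"
  assumes subspace: "complex_vector.subspace A\<^sub>0"
    and mult_closed: "\<lbrakk>x \<in> A\<^sub>0; y \<in> A\<^sub>0\<rbrakk> \<Longrightarrow> x \<cdot> y \<in> A\<^sub>0"
    and star_closed: "x \<in> A\<^sub>0 \<Longrightarrow> star x \<in> A\<^sub>0"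
    and right_mult_add1: "x \<in> A\<^sub>0 \<Longrightarrow> (a + b) \<cdot> x = a \<cdot> x + b \<cdot> x"
    and right_mult_scale1: "x \<in> A\<^sub>0 \<Longrightarrow> (c *\<^sub>C a) \<cdot> x = c *\<^sub>C (a \<cdot> x)"
    and right_mult_add2: "\<lbrakk>x \<in> A\<^sub>0; y \<in> A\<^sub>0\<rbrakk> \<Longrightarrow> a \<cdot> (x + y) = a \<cdot> x + a \<cdot> y"
    and right_mult_scale2: "x \<in> A\<^sub>0 \<Longrightarrow> a \<cdot> (c *\<^sub>C x) = c *\<^sub>C (a \<cdot> x)"
    and left_mult_add1: "\<lbrakk>x \<in> A\<^sub>0; y \<in> A\<^sub>0\<rbrakk> \<Longrightarrow> (x + y) \<cdot> a = x \<cdot> a + y \<cdot> a"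
    and left_mult_scale1: "x \<in> A\<^sub>0 \<Longrightarrow> (c *\<^sub>C x) \<cdot> a = c *\<^sub>C (x \<cdot> a)"
    and left_mult_add2: "x \<in> A\<^sub>0 \<Longrightarrow> x \<cdot> (a + b) = x \<cdot> a + x \<cdot> b"
    and left_mult_scale2: "x \<in> A\<^sub>0 \<Longrightarrow> x \<cdot> (c *\<^sub>C a) = c *\<^sub>C (x \<cdot> a)"
    and mult_assoc1: "\<lbrakk>x \<in> A\<^sub>0; y \<in> A\<^sub>0\<rbrakk> \<Longrightarrow> (x \<cdot> a) \<cdot> y = x \<cdot> (a \<cdot> y)"
    and mult_assoc2: "\<lbrakk>x \<in> A\<^sub>0; y \<in> A\<^sub>0\<rbrakk> \<Longrightarrow> a \<cdot> (x \<cdot> y) = (a \<cdot> x) \<cdot> y"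
    and star_add: "star (a + b) = star a + star b"
    and star_scale: "star (c *\<^sub>C a) = cnj c *\<^sub>C star a"
    and star_star: "star (star a) = a"
    and star_mult1: "x \<in> A\<^sub>0 \<Longrightarrow> star (a \<cdot> x) = star x \<cdot> star a"
    and star_mult2: "x \<in> A\<^sub>0 \<Longrightarrow> star (x \<cdot> a) = star a \<cdot> star x"

text \<open>Normed quasi *-algebras are understood to be unital, with a unit of norm 1.\<close>

locale normed_quasi_star_algebra =
  quasi_star_algebra A\<^sub>0 mul star + complex_norm N
  for A\<^sub>0 :: "'a::complex_vector set"
    and mul :: "'a \<Rightarrow> 'a \<Rightarrow> 'a" (infixl \<open>\<cdot>\<close> 70)
    and star :: "'a \<Rightarrow> 'a"
    and N :: "'a \<Rightarrow> real" +
  assumes unit: "\<exists>e\<in>A\<^sub>0. (\<forall>a. a \<cdot> e = a \<and> e \<cdot> a = a) \<and> N e = 1"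
    and norm_star: "N (star a) = N a"
    and dense: "norm_topology N closure_of A\<^sub>0 = UNIV"
    and mult_continuous:
      "x \<in> A\<^sub>0 \<Longrightarrow> continuous_map (norm_topology N) (norm_topology N) (\<lambda>a. a \<cdot> x)"

locale banach_quasi_star_algebra = normed_quasi_star_algebra +
  assumes complete: "norm_complete N"

definition sesquilinear :: "('a::complex_vector \<Rightarrow> 'a \<Rightarrow> complex) \<Rightarrow> bool" where
  "sesquilinear \<Omega> \<longleftrightarrow>
     (\<forall>a a' b. \<Omega> (a + a') b = \<Omega> a b + \<Omega> a' b) \<and>
     (\<forall>a b b'. \<Omega> a (b + b') = \<Omega> a b + \<Omega> a b') \<and>
     (\<forall>c a b. \<Omega> (c *\<^sub>C a) b = c * \<Omega> a b) \<and>
     (\<forall>c a b. \<Omega> a (c *\<^sub>C b) = cnj c * \<Omega> a b)"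

text \<open>In the order of \<open>complex\<close>, \<open>0 \<le> z\<close> means that \<open>z\<close> is real and nonnegative.\<close>

definition invariant_forms ::
  "'a::complex_vector set \<Rightarrow> ('a \<Rightarrow> 'a \<Rightarrow> 'a) \<Rightarrow> ('a \<Rightarrow> 'a) \<Rightarrow> ('a \<Rightarrow> real) \<Rightarrow> ('a \<Rightarrow> 'a \<Rightarrow> complex) set" where
  "invariant_forms A\<^sub>0 mul star N =
     {\<Omega>. sesquilinear \<Omega> \<and>
         (\<forall>a. 0 \<le> \<Omega> a a) \<and>
         (\<forall>a. \<forall>x\<in>A\<^sub>0. \<forall>y\<in>A\<^sub>0. \<Omega> (mul a x) y = \<Omega> x (mul (star a) y)) \<and>
         (\<forall>a b. cmod (\<Omega> a b) \<le> N a * N b)}"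

definition star_semisimple ::
  "'a::complex_vector set \<Rightarrow> ('a \<Rightarrow> 'a \<Rightarrow> 'a) \<Rightarrow> ('a \<Rightarrow> 'a) \<Rightarrow> ('a \<Rightarrow> real) \<Rightarrow> bool" where
  "star_semisimple A\<^sub>0 mul star N \<longleftrightarrow>
     (\<forall>a. a \<noteq> 0 \<longrightarrow> (\<exists>\<Omega>\<in>invariant_forms A\<^sub>0 mul star N. 0 < \<Omega> a a))"

section \<open>Well-definedness of the operations on tensor products\<close>

lemma clinear_simps:
  assumes "clinear f"
  shows "f (a + a') = f a + f a'" "f (c *\<^sub>C a) = c *\<^sub>C f a"
  using assms unfolding Vector_Spaces.linear_iff by blast+

lemma clinearI:
  assumes "\<And>a a'. f (a + a') = f a + f a'" "\<And>c a. f (c *\<^sub>C a) = c *\<^sub>C f a"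
  shows "clinear f"
  by (simp add: Vector_Spaces.linear_iff complex_vector.vector_space_axioms assms)

lemma cbilinear_simps:
  assumes "cbilinear f"
  shows "f (a + a') b = f a b + f a' b" "f a (b + b') = f a b + f a b'"
    "f (c *\<^sub>C a) b = c *\<^sub>C f a b" "f a (c *\<^sub>C b) = c *\<^sub>C f a b"
  using assms unfolding cbilinear_def Vector_Spaces.linear_iff by blast+

lemma tensor_add_left: "(a + a') \<otimes> b = a \<otimes> b + a' \<otimes> b"
proof (transfer, goal_cases)
  case (1 a a' b)
  have "free_basis (a + a') b - free_basis a b - free_basis a' b \<in> tensor_relations"
    unfolding tensor_relations_def by blast
  then show ?case
    using free_vector.span_base by (simp add: diff_diff_eq)
qed

lemma tensor_add_right: "a \<otimes> (b + b') = a \<otimes> b + a \<otimes> b'"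
proof (transfer, goal_cases)
  case (1 a b b')
  have "free_basis a (b + b') - free_basis a b - free_basis a b' \<in> tensor_relations"
    unfolding tensor_relations_def by blast
  then show ?case
    using free_vector.span_base by (simp add: diff_diff_eq)
qed

lemma tensor_scale_left: "(c *\<^sub>C a) \<otimes> b = c *\<^sub>C (a \<otimes> b)"
proof (transfer, goal_cases)
  case (1 c a b)
  have "free_basis (c *\<^sub>C a) b - free_scale c (free_basis a b) \<in> tensor_relations"
    unfolding tensor_relations_def by blast
  then show ?case by (rule free_vector.span_base)
qed

lemma tensor_scale_right: "a \<otimes> (c *\<^sub>C b) = c *\<^sub>C (a \<otimes> b)"
proof (transfer, goal_cases)
  case (1 a c b)
  have "free_basis a (c *\<^sub>C b) - free_scale c (free_basis a b) \<in> tensor_relations"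
    unfolding tensor_relations_def by blast
  then show ?case by (rule free_vector.span_base)
qed

lemmas tensor_bilinear = tensor_add_left tensor_add_right tensor_scale_left tensor_scale_right

definition free_sum :: "('x \<Rightarrow> 'c::complex_vector) \<Rightarrow> ('x \<Rightarrow>\<^sub>0 complex) \<Rightarrow> 'c" where
  "free_sum h p = (\<Sum>k\<in>Poly_Mapping.keys p. Poly_Mapping.lookup p k *\<^sub>C h k)"

lemma free_sum_superset:
  assumes "finite K" "Poly_Mapping.keys p \<subseteq> K"
  shows "free_sum h p = (\<Sum>k\<in>K. Poly_Mapping.lookup p k *\<^sub>C h k)"
  unfolding free_sum_def
  by (rule sum.mono_neutral_left) (use assms in \<open>auto simp: in_keys_iff\<close>)

lemma free_sum_cong:
  assumes "\<And>k. k \<in> Poly_Mapping.keys p \<Longrightarrow> h k = h' k"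
  shows "free_sum h p = free_sum h' p"
  unfolding free_sum_def using assms by (intro sum.cong) auto

lemma free_sum_add: "free_sum h (p + q) = free_sum h p + free_sum h q"
proof -
  let ?K = "Poly_Mapping.keys p \<union> Poly_Mapping.keys q"
  have "free_sum h (p + q) = (\<Sum>k\<in>?K. Poly_Mapping.lookup (p + q) k *\<^sub>C h k)"
    by (rule free_sum_superset) (use Poly_Mapping.keys_add[of p q] in simp_all)
  also have "\<dots> = (\<Sum>k\<in>?K. Poly_Mapping.lookup p k *\<^sub>C h k) + (\<Sum>k\<in>?K. Poly_Mapping.lookup q k *\<^sub>C h k)"
    by (simp add: lookup_add scaleC_add_left sum.distrib)
  also have "(\<Sum>k\<in>?K. Poly_Mapping.lookup p k *\<^sub>C h k) = free_sum h p"
    by (rule free_sum_superset[symmetric]) auto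
  also have "(\<Sum>k\<in>?K. Poly_Mapping.lookup q k *\<^sub>C h k) = free_sum h q"
    by (rule free_sum_superset[symmetric]) auto
  finally show ?thesis .
qed

lemma free_sum_scale: "free_sum h (free_scale c p) = c *\<^sub>C free_sum h p"
proof -
  have "free_sum h (free_scale c p) =
      (\<Sum>k\<in>Poly_Mapping.keys p. Poly_Mapping.lookup (free_scale c p) k *\<^sub>C h k)"
    by (rule free_sum_superset) (auto simp: in_keys_iff)
  then show ?thesis
    by (simp add: free_sum_def complex_vector.scale_sum_right scaleC_scaleC)
qed

lemma free_sum_diff: "free_sum h (p - q) = free_sum h p - free_sum h q"
  using free_sum_add[of h "p - q" q] by simp

lemma free_sum_zero [simp]: "free_sum h 0 = 0"
  by (simp add: free_sum_def)

lemma free_sum_single [simp]: "free_sum h (Poly_Mapping.single k c) = c *\<^sub>C h k"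
  by (simp add: free_sum_def)

lemma free_sum_add_fun: "free_sum (\<lambda>k. h k + h' k) p = free_sum h p + free_sum h' p"
  by (simp add: free_sum_def scaleC_add_right sum.distrib)

lemma free_sum_scale_fun: "free_sum (\<lambda>k. c *\<^sub>C h k) p = c *\<^sub>C free_sum h p"
  by (simp add: free_sum_def complex_vector.scale_sum_right mult.commute)

lemma free_sum_swap:
  "free_sum (\<lambda>k. free_sum (\<lambda>l. h k l) q) p = free_sum (\<lambda>l. free_sum (\<lambda>k. h k l) p) q"
  unfolding free_sum_def complex_vector.scale_sum_right
  by (subst sum.swap) (simp add: mult.commute)

lemma free_sum_relations:
  assumes f: "cbilinear f" and p: "p \<in> free_vector.span tensor_relations"
  shows "free_sum (\<lambda>(a, b). f a b) p = 0"
  using p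
proof (induction rule: free_vector.span_induct_alt)
  case base
  show ?case by simp
next
  case (step c x y)
  have "free_sum (\<lambda>(a, b). f a b) x = 0"
    using step.hyps unfolding tensor_relations_def
    by (auto simp: free_sum_diff free_sum_scale cbilinear_simps[OF f] simp del: map_single)
  then show ?case
    using step.IH by (simp add: free_sum_add free_sum_scale)
qed

lemma free_sum_eq:
  assumes "cbilinear f" "abs_tensor p = abs_tensor q"
  shows "free_sum (\<lambda>(a, b). f a b) p = free_sum (\<lambda>(a, b). f a b) q"
  using free_sum_relations[OF assms(1), of "p - q"] assms(2)
  by (simp add: tensor.abs_eq_iff free_sum_diff)

lemma abs_tensor_free_sum: "abs_tensor p = free_sum (\<lambda>(a, b). a \<otimes> b) p"
proof -
  have *: "abs_tensor (\<Sum>k\<in>K. free_scale (Poly_Mapping.lookup p k) (Poly_Mapping.single k 1))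
      = (\<Sum>k\<in>K. Poly_Mapping.lookup p k *\<^sub>C (case k of (a, b) \<Rightarrow> a \<otimes> b))"
    if "finite K" for K
    using that
  proof induction
    case empty
    show ?case by (simp add: zero_tensor_def)
  next
    case (insert k K)
    then show ?case
      by (simp add: plus_tensor.abs_eq[symmetric] scaleC_tensor.abs_eq[symmetric]
          tensor.abs_eq[symmetric] split: prod.split del: map_single)
  qed
  have "p = (\<Sum>k\<in>Poly_Mapping.keys p. free_scale (Poly_Mapping.lookup p k) (Poly_Mapping.single k 1))"
    by (rule poly_mapping_eqI)
      (auto simp: lookup_sum lookup_single when_def in_keys_iff if_distrib[of "(*) _"]
        simp del: map_single cong: if_cong)
  then show ?thesis
    using *[of "Poly_Mapping.keys p"] by (simp add: free_sum_def)
qed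

lemma tensor_rep_UNIV: "abs_tensor (tensor_rep UNIV UNIV u) = u"
proof -
  have "\<exists>p. Poly_Mapping.keys p \<subseteq> UNIV \<times> UNIV \<and> abs_tensor p = u"
    by (intro exI[of _ "rep_tensor u"]) (simp add: Quotient_abs_rep[OF Quotient_tensor])
  from someI_ex[OF this] show ?thesis
    by (simp add: tensor_rep_def)
qed

lemma tensor_rep_exists:
  assumes "u \<in> tensor_subspace S T"
  shows "\<exists>p. Poly_Mapping.keys p \<subseteq> S \<times> T \<and> abs_tensor p = u"
  using assms unfolding tensor_subspace_def
proof (induction rule: complex_vector.span_induct_alt)
  case base
  show ?case by (intro exI[of _ 0]) (simp add: zero_tensor_def)
next
  case (step c t v)
  then obtain a b p where *: "a \<in> S" "b \<in> T" "t = a \<otimes> b"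
    "Poly_Mapping.keys p \<subseteq> S \<times> T" "abs_tensor p = v"
    by auto
  have "Poly_Mapping.keys (Poly_Mapping.single (a, b) c + p) \<subseteq> S \<times> T"
    using Poly_Mapping.keys_add[of "Poly_Mapping.single (a, b) c" p] * by (auto split: if_splits)
  moreover have "abs_tensor (Poly_Mapping.single (a, b) c + p) = c *\<^sub>C t + v"
    using * by (simp add: abs_tensor_free_sum free_sum_add)
  ultimately show ?case by blast
qed

lemma tensor_rep_subspace:
  assumes "u \<in> tensor_subspace S T"
  shows "Poly_Mapping.keys (tensor_rep S T u) \<subseteq> S \<times> T" "abs_tensor (tensor_rep S T u) = u"
  using someI_ex[OF tensor_rep_exists[OF assms]] unfolding tensor_rep_def by auto

lemma tensor_subspace_abs:
  assumes "Poly_Mapping.keys p \<subseteq> S \<times> T"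
  shows "abs_tensor p \<in> tensor_subspace S T"
  unfolding abs_tensor_free_sum free_sum_def tensor_subspace_def
  by (intro complex_vector.span_sum complex_vector.span_scale complex_vector.span_base)
    (use assms in auto)

lemma tensor_cases:
  obtains p where "u = abs_tensor p"
  by (rule that[OF tensor_rep_UNIV[symmetric]])

lemma tensor_subspace_cases:
  assumes "u \<in> tensor_subspace S T"
  obtains p where "Poly_Mapping.keys p \<subseteq> S \<times> T" "u = abs_tensor p"
  using tensor_rep_exists[OF assms] by blast

lemma abs_tensor_add: "abs_tensor p + abs_tensor q = abs_tensor (p + q)"
  by (simp add: plus_tensor.abs_eq)

lemma abs_tensor_scale: "c *\<^sub>C abs_tensor p = abs_tensor (free_scale c p)"
  by (simp add: scaleC_tensor.abs_eq)

lemma tensor_map_abs: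
  assumes "clinear S" "clinear T"
  shows "tensor_map S T (abs_tensor p) = free_sum (\<lambda>(a, b). S a \<otimes> T b) p"
proof -
  have "cbilinear (\<lambda>a b. S a \<otimes> T b)"
    unfolding cbilinear_def
    by (auto intro!: clinearI simp: clinear_simps[OF assms(1)] clinear_simps[OF assms(2)] tensor_bilinear)
  from free_sum_eq[OF this tensor_rep_UNIV, of p]
  show ?thesis
    by (simp add: tensor_map_def Let_def free_sum_def case_prod_unfold)
qed

lemma tensor_map_tensor:
  assumes "clinear S" "clinear T"
  shows "tensor_map S T (a \<otimes> b) = S a \<otimes> T b"
  by (simp add: tensor.abs_eq tensor_map_abs[OF assms])

lemma clinear_tensor_map:
  assumes "clinear S" "clinear T"
  shows "clinear (tensor_map S T)"
proof (rule clinearI)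
  show "tensor_map S T (u + v) = tensor_map S T u + tensor_map S T v" for u v
    by (cases u rule: tensor_cases, cases v rule: tensor_cases)
      (simp add: abs_tensor_add tensor_map_abs[OF assms] free_sum_add)
  show "tensor_map S T (c *\<^sub>C u) = c *\<^sub>C tensor_map S T u" for c u
    by (cases u rule: tensor_cases)
      (simp add: abs_tensor_scale tensor_map_abs[OF assms] free_sum_scale)
qed

lemma map_cnj_add: "Poly_Mapping.map cnj (p + q) = Poly_Mapping.map cnj p + Poly_Mapping.map cnj q"
  by (rule poly_mapping_eqI) (auto simp: map.rep_eq lookup_add when_def simp flip: complex_cnj_add)

lemma map_cnj_scale:
  "Poly_Mapping.map cnj (free_scale c p) = free_scale (cnj c) (Poly_Mapping.map cnj p)"
  by (rule poly_mapping_eqI) (auto simp: map.rep_eq when_def)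

lemma map_cnj_diff: "Poly_Mapping.map cnj (p - q) = Poly_Mapping.map cnj p - Poly_Mapping.map cnj q"
  using map_cnj_add[of "p - q" q] by simp

lemma map_cnj_zero [simp]: "Poly_Mapping.map cnj 0 = 0"
  by (rule poly_mapping_eqI) (simp add: map.rep_eq)

lemma map_cnj_basis: "Poly_Mapping.map cnj (Poly_Mapping.single k 1) = Poly_Mapping.single k 1"
  by (simp add: when_def)

lemma keys_map_cnj: "Poly_Mapping.keys (Poly_Mapping.map cnj p) = Poly_Mapping.keys p"
  by (auto simp: in_keys_iff map.rep_eq when_def)

lemma free_sum_star_relations:
  assumes A: "quasi_star_algebra A\<^sub>0 multA starA" and B: "quasi_star_algebra B\<^sub>0 multB starB"
    and p: "p \<in> free_vector.span tensor_relations"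
  shows "free_sum (\<lambda>(a, b). starA a \<otimes> starB b) (Poly_Mapping.map cnj p) = 0"
  using p
proof (induction rule: free_vector.span_induct_alt)
  case base
  show ?case by simp
next
  case (step c x y)
  note star = quasi_star_algebra.star_add[OF A] quasi_star_algebra.star_add[OF B]
    quasi_star_algebra.star_scale[OF A] quasi_star_algebra.star_scale[OF B]
  have "free_sum (\<lambda>(a, b). starA a \<otimes> starB b) (Poly_Mapping.map cnj x) = 0"
    using step.hyps unfolding tensor_relations_def
    by (elim UnE CollectE exE conjE; hypsubst)
      (simp_all only: map_cnj_diff map_cnj_scale map_cnj_basis free_sum_diff free_sum_scale
        free_sum_single prod.case scaleC_one star tensor_bilinear, simp_all)
  then show ?case
    using step.IH by (simp add: free_sum_add free_sum_scale map_cnj_add map_cnj_scale)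
qed

lemma tensor_induct [case_names tensor add]:
  assumes "\<And>a b. P (a \<otimes> b)" "\<And>u v. \<lbrakk>P u; P v\<rbrakk> \<Longrightarrow> P (u + v)"
  shows "P u"
proof (cases u rule: tensor_cases)
  case (1 p)
  have "(0 :: 'a) \<otimes> (0 :: 'b) = 0" using tensor_scale_left[of 0 "0 :: 'a" "0 :: 'b"] by simp
  with assms(1)[of 0 0] have "P 0" by simp
  have "P (\<Sum>k\<in>K. Poly_Mapping.lookup p k *\<^sub>C (case k of (a, b) \<Rightarrow> a \<otimes> b))" if "finite K" for K
    using that
  proof (induction rule: finite_induct)
    case empty
    then show ?case using \<open>P 0\<close> by simp
  next
    case (insert k K)
    obtain a b where "k = (a, b)" by force
    then show ?case
      using insert assms(1)[of "Poly_Mapping.lookup p k *\<^sub>C a" b]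
      by (simp add: tensor_scale_left assms(2))
  qed
  then show ?thesis by (simp add: 1 abs_tensor_free_sum free_sum_def)
qed

lemma tensor_subspace_tensor: "\<lbrakk>x \<in> S; y \<in> T\<rbrakk> \<Longrightarrow> x \<otimes> y \<in> tensor_subspace S T"
  unfolding tensor_subspace_def by (rule complex_vector.span_base) blast

lemma subspace_tensor_subspace: "complex_vector.subspace (tensor_subspace S T)"
  unfolding tensor_subspace_def by (rule complex_vector.subspace_span)

lemma tensor_subspace_induct [consumes 2, case_names tensor add]:
  assumes "u \<in> tensor_subspace S T" and S: "complex_vector.subspace S"
    and *: "\<And>a b. \<lbrakk>a \<in> S; b \<in> T\<rbrakk> \<Longrightarrow> P (a \<otimes> b)"
    and add: "\<And>u v. \<lbrakk>u \<in> tensor_subspace S T; v \<in> tensor_subspace S T; P u; P v\<rbrakk> \<Longrightarrow> P (u + v)"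
    and zero: "P 0"
  shows "P u"
proof -
  have "u \<in> tensor_subspace S T \<and> P u"
    using assms(1) unfolding tensor_subspace_def[of S T]
  proof (induction rule: complex_vector.span_induct_alt)
    case base
    then show ?case using zero complex_vector.span_zero by blast
  next
    case (step c t v)
    then obtain a b where t: "a \<in> S" "b \<in> T" "t = a \<otimes> b" by auto
    have ca: "c *\<^sub>C a \<in> S" using t S by (simp add: complex_vector.subspace_scale)
    have 1: "c *\<^sub>C t = (c *\<^sub>C a) \<otimes> b" using t by (simp add: tensor_scale_left)
    have "c *\<^sub>C t \<in> tensor_subspace S T" "P (c *\<^sub>C t)"
      unfolding 1 using ca t * tensor_subspace_tensor by auto
    moreover have "v \<in> tensor_subspace S T" "P v"
      using step.IH unfolding tensor_subspace_def by auto
    ultimately show ?case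
      using add subspace_tensor_subspace complex_vector.subspace_add
      unfolding tensor_subspace_def[symmetric] by blast
  qed
  then show ?thesis ..
qed

lemma tensor_star_abs:
  assumes A: "quasi_star_algebra A\<^sub>0 multA starA" and B: "quasi_star_algebra B\<^sub>0 multB starB"
  shows "tensor_star starA starB (abs_tensor p) =
    free_sum (\<lambda>(a, b). starA a \<otimes> starB b) (Poly_Mapping.map cnj p)"
proof -
  let ?h = "\<lambda>(a, b). starA a \<otimes> starB b"
  define q where "q = tensor_rep UNIV UNIV (abs_tensor p)"
  have "abs_tensor q = abs_tensor p"
    by (simp add: q_def tensor_rep_UNIV)
  then have "q - p \<in> free_vector.span tensor_relations"
    by (simp add: tensor.abs_eq_iff)
  from free_sum_star_relations[OF A B this]
  have "free_sum ?h (Poly_Mapping.map cnj p) = free_sum ?h (Poly_Mapping.map cnj q)"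
    by (simp add: map_cnj_diff free_sum_diff)
  also have "\<dots> = tensor_star starA starB (abs_tensor p)"
    unfolding tensor_star_def free_sum_def keys_map_cnj q_def[symmetric] Let_def
    by (auto intro!: sum.cong simp: map.rep_eq when_def)
  finally show ?thesis by simp
qed

lemma tensor_star_simps:
  assumes A: "quasi_star_algebra A\<^sub>0 multA starA" and B: "quasi_star_algebra B\<^sub>0 multB starB"
  shows tensor_star_tensor: "tensor_star starA starB (a \<otimes> b) = starA a \<otimes> starB b"
    and tensor_star_add:
      "tensor_star starA starB (u + v) = tensor_star starA starB u + tensor_star starA starB v"
    and tensor_star_scale:
      "tensor_star starA starB (c *\<^sub>C u) = cnj c *\<^sub>C tensor_star starA starB u"
proof -
  show "tensor_star starA starB (a \<otimes> b) = starA a \<otimes> starB b"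
    by (simp add: tensor.abs_eq tensor_star_abs[OF A B] when_def)
  show "tensor_star starA starB (u + v) = tensor_star starA starB u + tensor_star starA starB v"
    by (cases u rule: tensor_cases, cases v rule: tensor_cases)
      (simp add: abs_tensor_add tensor_star_abs[OF A B] free_sum_add map_cnj_add)
  show "tensor_star starA starB (c *\<^sub>C u) = cnj c *\<^sub>C tensor_star starA starB u"
    by (cases u rule: tensor_cases)
      (simp add: abs_tensor_scale tensor_star_abs[OF A B] free_sum_scale map_cnj_scale)
qed

definition right_action :: "'a::complex_vector set \<Rightarrow> ('a \<Rightarrow> 'a \<Rightarrow> 'a) \<Rightarrow> bool" where
  "right_action A\<^sub>0 m \<longleftrightarrow> complex_vector.subspace A\<^sub>0 \<and> (\<forall>x\<in>A\<^sub>0. clinear (\<lambda>a. m a x)) \<and>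
     (\<forall>a. \<forall>x\<in>A\<^sub>0. \<forall>y\<in>A\<^sub>0. m a (x + y) = m a x + m a y) \<and> (\<forall>a c. \<forall>x\<in>A\<^sub>0. m a (c *\<^sub>C x) = c *\<^sub>C m a x)"

lemma (in quasi_star_algebra) right_action: "right_action A\<^sub>0 (\<cdot>)"
  unfolding right_action_def
  by (auto intro!: clinearI simp: subspace right_mult_add1 right_mult_scale1 right_mult_add2
      right_mult_scale2)

lemma (in quasi_star_algebra) left_action: "right_action A\<^sub>0 (\<lambda>a b. b \<cdot> a)"
  unfolding right_action_def
  by (auto intro!: clinearI simp: subspace left_mult_add1 left_mult_scale1 left_mult_add2
      left_mult_scale2)

lemma right_action_extend:
  assumes "right_action A\<^sub>0 m"
  obtains L where "clinear L" "\<And>x. x \<in> A\<^sub>0 \<Longrightarrow> L x = m a x"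
proof -
  have sub: "complex_vector.subspace A\<^sub>0"
    and add: "\<And>x y. \<lbrakk>x \<in> A\<^sub>0; y \<in> A\<^sub>0\<rbrakk> \<Longrightarrow> m a (x + y) = m a x + m a y"
    and scale: "\<And>c x. x \<in> A\<^sub>0 \<Longrightarrow> m a (c *\<^sub>C x) = c *\<^sub>C m a x"
    using assms unfolding right_action_def by auto
  obtain B where B: "B \<subseteq> A\<^sub>0" "complex_vector.independent B" "A\<^sub>0 \<subseteq> complex_vector.span B"
    using complex_vector.maximal_independent_subset by metis
  interpret vector_space_pair "scaleC :: complex \<Rightarrow> 'a \<Rightarrow> 'a" "scaleC :: complex \<Rightarrow> 'a \<Rightarrow> 'a"
    by unfold_locales
  obtain L where L: "clinear L" "\<forall>x\<in>B. L x = m a x"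
    using linear_independent_extend[OF B(2)] by blast
  have "0 \<in> A\<^sub>0" by (rule complex_vector.subspace_0[OF sub])
  have "x \<in> A\<^sub>0 \<and> L x = m a x" if "x \<in> complex_vector.span B" for x
    using that
  proof (induction rule: complex_vector.span_induct_alt)
    case base
    show ?case using \<open>0 \<in> A\<^sub>0\<close> scale[of 0 0] clinear_simps(2)[OF L(1), of 0 0] by simp
  next
    case (step c x y)
    then have "x \<in> A\<^sub>0" "c *\<^sub>C x \<in> A\<^sub>0" "y \<in> A\<^sub>0"
      using B sub complex_vector.subspace_scale by blast+
    then show ?case
      using step L add scale sub by (simp add: clinear_simps[OF L(1)] complex_vector.subspace_add)
  qed
  then show ?thesis using L B that by blast
qed

definition double_sum ::
  "('a \<Rightarrow> 'a \<Rightarrow> 'a) \<Rightarrow> ('b \<Rightarrow> 'b \<Rightarrow> 'b) \<Rightarrow> ('a \<times> 'b \<Rightarrow>\<^sub>0 complex) \<Rightarrow> ('a \<times> 'b \<Rightarrow>\<^sub>0 complex) \<Rightarrow>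
   ('a::complex_vector, 'b::complex_vector) tensor" where
  "double_sum m m' p q = free_sum (\<lambda>(a, b). free_sum (\<lambda>(x, y). m a x \<otimes> m' b y) q) p"

lemma double_sum_flip: "double_sum m m' p q = double_sum (\<lambda>a b. m b a) (\<lambda>a b. m' b a) q p"
  unfolding double_sum_def case_prod_unfold by (rule free_sum_swap)

lemma double_sum_add1: "double_sum m m' (p + p') q = double_sum m m' p q + double_sum m m' p' q"
  by (simp add: double_sum_def free_sum_add)

lemma double_sum_scale1: "double_sum m m' (free_scale c p) q = c *\<^sub>C double_sum m m' p q"
  by (simp add: double_sum_def free_sum_scale)

lemma double_sum_add2: "double_sum m m' p (q + q') = double_sum m m' p q + double_sum m m' p q'"
  by (simp only: double_sum_flip[of m m'] double_sum_add1)

lemma double_sum_scale2: "double_sum m m' p (free_scale c q) = c *\<^sub>C double_sum m m' p q"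
  by (simp only: double_sum_flip[of m m'] double_sum_scale1)

lemma double_sum_cong:
  assumes m: "right_action A\<^sub>0 m" and m': "right_action B\<^sub>0 m'"
    and q: "Poly_Mapping.keys q \<subseteq> A\<^sub>0 \<times> B\<^sub>0" "Poly_Mapping.keys q' \<subseteq> A\<^sub>0 \<times> B\<^sub>0"
    and eq: "abs_tensor p = abs_tensor p'" "abs_tensor q = abs_tensor q'"
  shows "double_sum m m' p q = double_sum m m' p' q'"
proof -
  have lin: "\<And>x. x \<in> A\<^sub>0 \<Longrightarrow> clinear (\<lambda>a. m a x)" "\<And>y. y \<in> B\<^sub>0 \<Longrightarrow> clinear (\<lambda>b. m' b y)"
    using m m' unfolding right_action_def by auto
  have "cbilinear (\<lambda>a b. free_sum (\<lambda>(x, y). m a x \<otimes> m' b y) q)"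
    unfolding cbilinear_def
  proof (intro conjI allI clinearI)
    show "free_sum (\<lambda>(x, y). m (a + a') x \<otimes> m' b y) q =
        free_sum (\<lambda>(x, y). m a x \<otimes> m' b y) q + free_sum (\<lambda>(x, y). m a' x \<otimes> m' b y) q" for a a' b
      unfolding free_sum_add_fun[symmetric]
      by (rule free_sum_cong) (use q in \<open>auto simp: clinear_simps[OF lin(1)] clinear_simps[OF lin(2)] tensor_bilinear\<close>)
    show "free_sum (\<lambda>(x, y). m a x \<otimes> m' (b + b') y) q =
        free_sum (\<lambda>(x, y). m a x \<otimes> m' b y) q + free_sum (\<lambda>(x, y). m a x \<otimes> m' b' y) q" for a b b'
      unfolding free_sum_add_fun[symmetric]
      by (rule free_sum_cong) (use q in \<open>auto simp: clinear_simps[OF lin(1)] clinear_simps[OF lin(2)] tensor_bilinear\<close>)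
    show "free_sum (\<lambda>(x, y). m (c *\<^sub>C a) x \<otimes> m' b y) q =
        c *\<^sub>C free_sum (\<lambda>(x, y). m a x \<otimes> m' b y) q" for a b c
      unfolding free_sum_scale_fun[symmetric]
      by (rule free_sum_cong) (use q in \<open>auto simp: clinear_simps[OF lin(1)] clinear_simps[OF lin(2)] tensor_bilinear\<close>)
    show "free_sum (\<lambda>(x, y). m a x \<otimes> m' (c *\<^sub>C b) y) q =
        c *\<^sub>C free_sum (\<lambda>(x, y). m a x \<otimes> m' b y) q" for a b c
      unfolding free_sum_scale_fun[symmetric]
      by (rule free_sum_cong) (use q in \<open>auto simp: clinear_simps[OF lin(1)] clinear_simps[OF lin(2)] tensor_bilinear\<close>)
  qed
  then have "double_sum m m' p q = double_sum m m' p' q"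
    unfolding double_sum_def using eq(1) by (rule free_sum_eq)
  also have "free_sum (\<lambda>(x, y). m a x \<otimes> m' b y) q = free_sum (\<lambda>(x, y). m a x \<otimes> m' b y) q'" for a b
  proof -
    obtain L where L: "clinear L" "\<And>x. x \<in> A\<^sub>0 \<Longrightarrow> L x = m a x"
      using right_action_extend[OF m] by blast
    obtain L' where L': "clinear L'" "\<And>y. y \<in> B\<^sub>0 \<Longrightarrow> L' y = m' b y"
      using right_action_extend[OF m'] by blast
    have *: "free_sum (\<lambda>(x, y). m a x \<otimes> m' b y) r = tensor_map L L' (abs_tensor r)"
      if "Poly_Mapping.keys r \<subseteq> A\<^sub>0 \<times> B\<^sub>0" for r
      unfolding tensor_map_abs[OF L(1) L'(1)]
      by (rule free_sum_cong) (use that L L' in auto)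
    show ?thesis
      using *[OF q(1)] *[OF q(2)] eq(2) by simp
  qed
  then have "double_sum m m' p' q = double_sum m m' p' q'"
    unfolding double_sum_def by simp
  finally show ?thesis .
qed

lemma tensor_mult_double_sum:
  "tensor_mult A\<^sub>0 multA B\<^sub>0 multB u w =
    (if w \<in> tensor_subspace A\<^sub>0 B\<^sub>0
     then double_sum multA multB (tensor_rep UNIV UNIV u) (tensor_rep A\<^sub>0 B\<^sub>0 w)
     else double_sum multA multB (tensor_rep A\<^sub>0 B\<^sub>0 u) (tensor_rep UNIV UNIV w))"
  by (simp add: tensor_mult_def double_sum_def free_sum_def complex_vector.scale_sum_right
      case_prod_unfold)

context
  fixes A\<^sub>0 :: "'a::complex_vector set" and B\<^sub>0 :: "'b::complex_vector set"
    and multA multB starA starB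
  assumes A: "quasi_star_algebra A\<^sub>0 multA starA" and B: "quasi_star_algebra B\<^sub>0 multB starB"
begin

interpretation A: quasi_star_algebra A\<^sub>0 multA starA by (rule A)
interpretation B: quasi_star_algebra B\<^sub>0 multB starB by (rule B)

abbreviation (input) "AB\<^sub>0 \<equiv> tensor_subspace A\<^sub>0 B\<^sub>0"
abbreviation (input) "multAB \<equiv> tensor_mult A\<^sub>0 multA B\<^sub>0 multB"
abbreviation (input) "starAB \<equiv> tensor_star starA starB"

lemma tensor_mult_right:
  assumes "Poly_Mapping.keys q \<subseteq> A\<^sub>0 \<times> B\<^sub>0"
  shows "multAB (abs_tensor p) (abs_tensor q) = double_sum multA multB p q"
  unfolding tensor_mult_double_sum if_P[OF tensor_subspace_abs[OF assms]]
  by (rule double_sum_cong[OF A.right_action B.right_action])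
    (simp_all add: tensor_rep_UNIV assms tensor_rep_subspace[OF tensor_subspace_abs[OF assms]])

lemma tensor_mult_left:
  assumes p: "Poly_Mapping.keys p \<subseteq> A\<^sub>0 \<times> B\<^sub>0"
  shows "multAB (abs_tensor p) (abs_tensor q) = double_sum multA multB p q"
proof (cases "abs_tensor q \<in> AB\<^sub>0")
  case True
  then obtain q' where q': "Poly_Mapping.keys q' \<subseteq> A\<^sub>0 \<times> B\<^sub>0" "abs_tensor q = abs_tensor q'"
    by (rule tensor_subspace_cases)
  have "double_sum multA multB p q = double_sum multA multB p q'"
    unfolding double_sum_flip[of multA multB]
    by (rule double_sum_cong[OF A.left_action B.left_action]) (use p q' in auto)
  then show ?thesis
    using tensor_mult_right[OF q'(1)] q'(2) by simp
next
  case False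
  have "double_sum multA multB p q =
      double_sum multA multB (tensor_rep A\<^sub>0 B\<^sub>0 (abs_tensor p)) (tensor_rep UNIV UNIV (abs_tensor q))"
    unfolding double_sum_flip[of multA multB]
    by (rule double_sum_cong[OF A.left_action B.left_action])
      (use p tensor_rep_subspace[OF tensor_subspace_abs[OF p]] in \<open>auto simp: tensor_rep_UNIV\<close>)
  then show ?thesis
    using False by (simp add: tensor_mult_double_sum)
qed

lemma tensor_mult_tensor_right:
  assumes "x \<in> A\<^sub>0" "y \<in> B\<^sub>0"
  shows "multAB (a \<otimes> b) (x \<otimes> y) = multA a x \<otimes> multB b y"
  using assms unfolding tensor.abs_eq
  by (subst tensor_mult_right) (auto simp: double_sum_def tensor.abs_eq)

lemma tensor_mult_tensor_left:
  assumes "x \<in> A\<^sub>0" "y \<in> B\<^sub>0"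
  shows "multAB (x \<otimes> y) (a \<otimes> b) = multA x a \<otimes> multB y b"
  using assms unfolding tensor.abs_eq
  by (subst tensor_mult_left) (auto simp: double_sum_def tensor.abs_eq)

lemma keys_scale_subset: "Poly_Mapping.keys p \<subseteq> K \<Longrightarrow> Poly_Mapping.keys (free_scale c p) \<subseteq> K"
  by (auto simp: in_keys_iff)

lemma keys_add_subset:
  "\<lbrakk>Poly_Mapping.keys p \<subseteq> K; Poly_Mapping.keys q \<subseteq> K\<rbrakk> \<Longrightarrow> Poly_Mapping.keys (p + q) \<subseteq> K"
  using Poly_Mapping.keys_add[of p q] by blast

lemma tensor_mult_bilinear:
  shows "w \<in> AB\<^sub>0 \<Longrightarrow> multAB (u + v) w = multAB u w + multAB v w"
    and "w \<in> AB\<^sub>0 \<Longrightarrow> multAB (c *\<^sub>C u) w = c *\<^sub>C multAB u w"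
    and "\<lbrakk>w \<in> AB\<^sub>0; z \<in> AB\<^sub>0\<rbrakk> \<Longrightarrow> multAB u (w + z) = multAB u w + multAB u z"
    and "w \<in> AB\<^sub>0 \<Longrightarrow> multAB u (c *\<^sub>C w) = c *\<^sub>C multAB u w"
    and "w \<in> AB\<^sub>0 \<Longrightarrow> multAB w (u + v) = multAB w u + multAB w v"
    and "w \<in> AB\<^sub>0 \<Longrightarrow> multAB w (c *\<^sub>C u) = c *\<^sub>C multAB w u"
    and "\<lbrakk>w \<in> AB\<^sub>0; z \<in> AB\<^sub>0\<rbrakk> \<Longrightarrow> multAB (w + z) u = multAB w u + multAB z u"
    and "w \<in> AB\<^sub>0 \<Longrightarrow> multAB (c *\<^sub>C w) u = c *\<^sub>C multAB w u"
proof -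
  note D = double_sum_add1 double_sum_scale1 double_sum_add2 double_sum_scale2
    abs_tensor_add abs_tensor_scale tensor_mult_left tensor_mult_right keys_scale_subset keys_add_subset
  obtain p where u: "u = abs_tensor p" by (rule tensor_cases)
  obtain q where v: "v = abs_tensor q" by (rule tensor_cases)
  show "multAB (u + v) w = multAB u w + multAB v w" if "w \<in> AB\<^sub>0"
    using that by (rule tensor_subspace_cases) (simp add: u v D)
  show "multAB (c *\<^sub>C u) w = c *\<^sub>C multAB u w" if "w \<in> AB\<^sub>0"
    using that by (rule tensor_subspace_cases) (simp add: u v D)
  show "multAB u (w + z) = multAB u w + multAB u z" if "w \<in> AB\<^sub>0" "z \<in> AB\<^sub>0"
    by (rule tensor_subspace_cases[OF that(1)], rule tensor_subspace_cases[OF that(2)]) (simp add: u v D)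
  show "multAB u (c *\<^sub>C w) = c *\<^sub>C multAB u w" if "w \<in> AB\<^sub>0"
    using that by (rule tensor_subspace_cases) (simp add: u v D)
  show "multAB w (u + v) = multAB w u + multAB w v" if "w \<in> AB\<^sub>0"
    using that by (rule tensor_subspace_cases) (simp add: u v D)
  show "multAB w (c *\<^sub>C u) = c *\<^sub>C multAB w u" if "w \<in> AB\<^sub>0"
    using that by (rule tensor_subspace_cases) (simp add: u v D)
  show "multAB (w + z) u = multAB w u + multAB z u" if "w \<in> AB\<^sub>0" "z \<in> AB\<^sub>0"
    by (rule tensor_subspace_cases[OF that(1)], rule tensor_subspace_cases[OF that(2)]) (simp add: u v D)
  show "multAB (c *\<^sub>C w) u = c *\<^sub>C multAB w u" if "w \<in> AB\<^sub>0"
    using that by (rule tensor_subspace_cases) (simp add: u v D)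
qed

lemma tensor_zero [simp]: "starAB 0 = 0" "multAB 0 u = 0" "multAB u 0 = 0"
proof -
  have 0: "0 \<in> AB\<^sub>0" by (rule complex_vector.subspace_0[OF subspace_tensor_subspace])
  show "starAB 0 = 0" using tensor_star_scale[OF A B, of 0 0] by simp
  show "multAB 0 u = 0" using tensor_mult_bilinear(8)[OF 0, where c = 0 and u = u] by simp
  show "multAB u 0 = 0" using tensor_mult_bilinear(4)[OF 0, where c = 0 and u = u] by simp
qed

text \<open>The tensor product of quasi *-algebras is the quasi *-algebra determined by the
  formulas \<open>tensor_mult_tensor_right\<close>, \<open>tensor_mult_tensor_left\<close> and \<open>tensor_star_tensor\<close>.\<close>

theorem tensor_quasi_star_algebra: "quasi_star_algebra AB\<^sub>0 multAB starAB"
proof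
  note A_sub = A.subspace
  note T = tensor_mult_tensor_right tensor_mult_tensor_left tensor_star_tensor[OF A B]
    A.mult_closed B.mult_closed A.star_closed B.star_closed tensor_subspace_tensor
    A.star_star B.star_star A.mult_assoc1 B.mult_assoc1 A.mult_assoc2 B.mult_assoc2
    A.star_mult1 B.star_mult1 A.star_mult2 B.star_mult2
  show sub: "complex_vector.subspace AB\<^sub>0" by (rule subspace_tensor_subspace)
  note add = complex_vector.subspace_add[OF sub] complex_vector.subspace_0[OF sub]
  note lin = tensor_mult_bilinear tensor_star_add[OF A B] tensor_star_scale[OF A B]
  fix u v :: "('a, 'b) tensor" and c
  show "starAB (u + v) = starAB u + starAB v" "starAB (c *\<^sub>C u) = cnj c *\<^sub>C starAB u"
    by (fact lin)+
  show star_star: "starAB (starAB u) = u"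
    by (induction u rule: tensor_induct) (simp_all add: T lin)
  fix x
  assume x: "x \<in> AB\<^sub>0"
  show "multAB (u + v) x = multAB u x + multAB v x" "multAB (c *\<^sub>C u) x = c *\<^sub>C multAB u x"
    "multAB u (c *\<^sub>C x) = c *\<^sub>C multAB u x" "multAB x (u + v) = multAB x u + multAB x v"
    "multAB x (c *\<^sub>C u) = c *\<^sub>C multAB x u" "multAB (c *\<^sub>C x) u = c *\<^sub>C multAB x u"
    using x by (fact lin)+
  show star_closed: "starAB x \<in> AB\<^sub>0"
    using x A_sub by (induction rule: tensor_subspace_induct) (simp_all add: T lin add)
  have star_closed': "starAB z \<in> AB\<^sub>0" if "z \<in> AB\<^sub>0" for z
    using that A_sub by (induction rule: tensor_subspace_induct) (simp_all add: T lin add)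
  show star1: "starAB (multAB u x) = multAB (starAB x) (starAB u)"
    using x A_sub
  proof (induction rule: tensor_subspace_induct)
    case (tensor a b)
    then show ?case by (induction u rule: tensor_induct) (simp_all add: T lin)
  qed (simp_all add: lin star_closed')
  show star2: "starAB (multAB x u) = multAB (starAB u) (starAB x)"
    using x A_sub
  proof (induction rule: tensor_subspace_induct)
    case (tensor a b)
    then show ?case by (induction u rule: tensor_induct) (simp_all add: T lin)
  qed (simp_all add: lin star_closed')
  fix y
  assume y: "y \<in> AB\<^sub>0"
  show "multAB u (x + y) = multAB u x + multAB u y" "multAB (x + y) u = multAB x u + multAB y u"
    using x y by (fact lin)+
  have closed: "multAB w z \<in> AB\<^sub>0" if "w \<in> AB\<^sub>0" "z \<in> AB\<^sub>0" for w z
    using that(1) A_sub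
  proof (induction rule: tensor_subspace_induct)
    case (tensor a b)
    show ?case
      using that(2) A_sub
      by (induction rule: tensor_subspace_induct) (use tensor in \<open>simp_all add: T lin add\<close>)
  qed (simp_all add: lin add that)
  then show "multAB x y \<in> AB\<^sub>0" using x y by blast
  show "multAB (multAB x u) y = multAB x (multAB u y)"
    using x A_sub
  proof (induction rule: tensor_subspace_induct)
    case x: (tensor a b)
    show ?case
      using y A_sub
    proof (induction rule: tensor_subspace_induct)
      case (tensor a' b')
      then show ?case using x by (induction u rule: tensor_induct) (simp_all add: T lin)
    qed (use x in \<open>simp_all add: lin T\<close>)
  qed (use y in \<open>simp_all add: lin\<close>)
  show "multAB u (multAB x y) = multAB (multAB u x) y"
    using x A_sub
  proof (induction rule: tensor_subspace_induct)
    case x: (tensor a b)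
    show ?case
      using y A_sub
    proof (induction rule: tensor_subspace_induct)
      case (tensor a' b')
      then show ?case using x by (induction u rule: tensor_induct) (simp_all add: T lin)
    qed (use x in \<open>simp_all add: lin T closed\<close>)
  qed (use y in \<open>simp_all add: lin closed\<close>)
qed

end

end

theory Submission
  imports Defs
begin

text \<open>A positive form on the tensor product restricts along \<open>a \<mapsto> a \<otimes> e\<close>, which is isometric
  because the units have norm 1; this gives one direction. Conversely, let \<open>\<Omega>\<^sub>1\<close>, \<open>\<Omega>\<^sub>2\<close> be
  invariant forms on the factors. Their tensor product is positive, since every tensor is a sum of
  elementary ones with \<open>\<Omega>\<^sub>1\<close>-orthogonal first components. Uniformity, applied to the rank-one
  operators \<open>\<Omega>\<^sub>1(\<cdot>, a)e\<close> and \<open>\<Omega>\<^sub>2(\<cdot>, b)e\<close>, makes it continuous in each variable, so its unit ball is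
  a barrel, and barrelledness makes it jointly bounded. If all these forms vanish at \<open>(u, u)\<close>, then
  by Cauchy-Schwarz all slices \<open>(\<Omega>\<^sub>1(\<cdot>, a) \<otimes> id) u\<close> vanish, by *-semisimplicity of the second
  factor; expanding \<open>u\<close> along a basis of that factor, *-semisimplicity of the first gives \<open>u = 0\<close>.\<close>

text \<open>Scalars become a complex vector space, so that scalar-valued bilinear maps fall under
  \<open>cbilinear\<close> and can be lifted to the tensor product.\<close>

instantiation complex :: complex_vector
begin

definition scaleC_complex :: "complex \<Rightarrow> complex \<Rightarrow> complex" where
  [simp]: "scaleC_complex c z = c * z"

instance
  by standard (simp_all add: scaleR_conv_of_real algebra_simps)

end

section \<open>Positive sesquilinear forms\<close>

lemma sesquilinear_simps:
  assumes "sesquilinear \<Omega>"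
  shows "\<Omega> (a + a') b = \<Omega> a b + \<Omega> a' b" "\<Omega> a (b + b') = \<Omega> a b + \<Omega> a b'"
    "\<Omega> (c *\<^sub>C a) b = c * \<Omega> a b" "\<Omega> a (c *\<^sub>C b) = cnj c * \<Omega> a b"
  using assms unfolding sesquilinear_def by blast+

locale positive_form =
  fixes \<Omega> :: "'a::complex_vector \<Rightarrow> 'a \<Rightarrow> complex"
  assumes sesq: "sesquilinear \<Omega>" and nonneg: "0 \<le> \<Omega> a a"
begin

lemmas form_simps = sesquilinear_simps[OF sesq]

lemma form_zero [simp]: "\<Omega> 0 b = 0" "\<Omega> a 0 = 0"
  using form_simps(3)[of 0 0 b] form_simps(4)[of a 0 0] by simp_all

lemma form_sum_left: "\<Omega> (sum f I) b = (\<Sum>i\<in>I. \<Omega> (f i) b)"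
  by (induction I rule: infinite_finite_induct) (simp_all add: form_simps)

lemma form_diff_left: "\<Omega> (a - a') b = \<Omega> a b - \<Omega> a' b"
  using form_simps(1)[of "a - a'" a' b] by simp

lemma form_self: "\<Omega> a a = complex_of_real (Re (\<Omega> a a))" "0 \<le> Re (\<Omega> a a)"
  using nonneg[of a] by (simp_all add: complex_eq_iff less_eq_complex_def)

text \<open>Polarisation: the values at \<open>a + b\<close> and \<open>a + \<i> *\<^sub>C b\<close>
  are real, and their imaginary parts compare the imaginary and the real parts of
  \<open>\<Omega> a b\<close> and \<open>\<Omega> b a\<close>.\<close>

lemma hermitian: "\<Omega> b a = cnj (\<Omega> a b)"
proof -
  have "Im (\<Omega> (a + b) (a + b)) = 0" "Im (\<Omega> (a + \<i> *\<^sub>C b) (a + \<i> *\<^sub>C b)) = 0"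
    "Im (\<Omega> a a) = 0" "Im (\<Omega> b b) = 0"
    using nonneg[of "a + b"] nonneg[of "a + \<i> *\<^sub>C b"] nonneg[of a] nonneg[of b]
    by (simp_all add: less_eq_complex_def)
  then show ?thesis
    by (simp add: form_simps complex_eq_iff)
qed

text \<open>With \<open>z = \<Omega> a b\<close>, positivity at \<open>a - t z b\<close> for real
  \<open>t\<close> gives a nonnegative real polynomial in \<open>t\<close> of degree at most 2. The
  multiplier \<open>z\<close> turns both cross terms into \<open>-t |z|^2\<close>.\<close>

lemma Cauchy_Schwarz: "(cmod (\<Omega> a b))\<^sup>2 \<le> Re (\<Omega> a a) * Re (\<Omega> b b)"
proof -
  define z where "z = \<Omega> a b"
  have expand: "Re (\<Omega> (a - (complex_of_real t * z) *\<^sub>C b) (a - (complex_of_real t * z) *\<^sub>C b)) =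
      Re (\<Omega> a a) - 2 * t * (cmod z)\<^sup>2 + t\<^sup>2 * (cmod z)\<^sup>2 * Re (\<Omega> b b)" for t
  proof -
    have minus: "a - (complex_of_real t * z) *\<^sub>C b = a + (- complex_of_real t * z) *\<^sub>C b"
      by simp
    have "\<Omega> b a = cnj z" "\<Omega> a b = z"
      by (simp_all add: z_def hermitian[of b a])
    moreover have "Im (\<Omega> b b) = 0"
      using nonneg[of b] by (simp add: less_eq_complex_def)
    ultimately show ?thesis
      unfolding minus form_simps cmod_power2
      by (simp add: power2_eq_square algebra_simps)
  qed
  have pos: "0 \<le> Re (\<Omega> a a) - 2 * t * (cmod z)\<^sup>2 + t\<^sup>2 * (cmod z)\<^sup>2 * Re (\<Omega> b b)" for t
    unfolding expand[symmetric] by (rule form_self)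
  show ?thesis
  proof (cases "Re (\<Omega> b b) = 0")
    case True
    have "(cmod z)\<^sup>2 \<le> 0"
    proof (rule ccontr)
      assume "\<not> (cmod z)\<^sup>2 \<le> 0"
      \<comment> \<open>If \<open>\<Omega> b b\<close> vanishes, the polynomial is affine in
        \<open>t\<close>; at this \<open>t\<close> it equals
        \<open>-\<Omega> a a - 2 < 0\<close>.\<close>
      then show False
        using pos[of "(Re (\<Omega> a a) + 1) / (cmod z)\<^sup>2"] form_self(2)[of a] True by simp
    qed
    then show ?thesis using True by (simp add: z_def)
  next
    case False
    then have "0 < Re (\<Omega> b b)" using form_self(2)[of b] by simp
    \<comment> \<open>The minimiser \<open>t = 1 / \<Omega> b b\<close> gives
      \<open>0 \<le> \<Omega> a a - |z|^2 / \<Omega> b b\<close>.\<close>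
    then show ?thesis
      using pos[of "1 / Re (\<Omega> b b)"]
      by (simp add: z_def[symmetric] power2_eq_square field_simps)
  qed
qed

lemma null_left: "\<Omega> a a = 0 \<Longrightarrow> \<Omega> a b = 0"
  using Cauchy_Schwarz[of a b] by simp

section \<open>The unit ball of a positive form and barrelledness\<close>

lemma unit_ball_convex: "convex {a. Re (\<Omega> a a) \<le> 1}"
proof (rule convexI, clarify)
  fix a b :: 'a and s t :: real
  assume ab: "Re (\<Omega> a a) \<le> 1" "Re (\<Omega> b b) \<le> 1" and st: "0 \<le> s" "0 \<le> t" "s + t = 1"
  have "(cmod (\<Omega> a b))\<^sup>2 \<le> 1 * 1"
    by (rule order_trans[OF Cauchy_Schwarz mult_mono]) (use ab form_self(2) in auto)
  then have "Re (\<Omega> a b) \<le> 1"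
    using complex_Re_le_cmod[of "\<Omega> a b"] by (simp add: abs_square_le_1)
  then have "s\<^sup>2 * Re (\<Omega> a a) + t\<^sup>2 * Re (\<Omega> b b) + 2 * (s * t) * Re (\<Omega> a b) \<le>
      s\<^sup>2 * 1 + t\<^sup>2 * 1 + 2 * (s * t) * 1"
    using ab st by (intro add_mono mult_left_mono) auto
  also have "\<dots> = (s + t)\<^sup>2" by (simp add: power2_sum)
  also have "\<dots> = 1" using st by simp
  also have "s\<^sup>2 * Re (\<Omega> a a) + t\<^sup>2 * Re (\<Omega> b b) + 2 * (s * t) * Re (\<Omega> a b) =
      Re (\<Omega> (s *\<^sub>R a + t *\<^sub>R b) (s *\<^sub>R a + t *\<^sub>R b))"
    by (simp add: scaleR_scaleC form_simps hermitian[of b a] power2_eq_square algebra_simps)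
  finally show "Re (\<Omega> (s *\<^sub>R a + t *\<^sub>R b) (s *\<^sub>R a + t *\<^sub>R b)) \<le> 1" .
qed

lemma Re_form_scale: "Re (\<Omega> (c *\<^sub>C a) (c *\<^sub>C a)) = (cmod c)\<^sup>2 * Re (\<Omega> a a)"
proof -
  have "\<Omega> (c *\<^sub>C a) (c *\<^sub>C a) = complex_of_real ((cmod c)\<^sup>2) * \<Omega> a a"
    by (simp add: form_simps complex_norm_square del: of_real_power)
  then show ?thesis by simp
qed

text \<open>Continuity in the first variable alone is enough for closedness: if
  \<open>\<Omega> a a > 1\<close>, then for \<open>b\<close> near \<open>a\<close> the number
  \<open>|\<Omega> b a|\<close> still exceeds \<open>sqrt (\<Omega> a a)\<close>, and Cauchy-Schwarz
  forces \<open>\<Omega> b b > 1\<close>.\<close>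

lemma unit_ball_barrel:
  assumes N: "complex_norm N" and bounded: "\<And>b. \<exists>C. \<forall>a. cmod (\<Omega> a b) \<le> C * N a"
  shows "barrel N {a. Re (\<Omega> a a) \<le> 1}"
  unfolding barrel_def
proof (intro conjI allI impI)
  interpret N: complex_norm N by (rule N)
  interpret M: Metric_space UNIV "norm_dist N" by (rule N.Metric_space_norm_dist)
  show "closedin (norm_topology N) {a. Re (\<Omega> a a) \<le> 1}"
    unfolding M.closedin_metric
  proof (intro conjI allI impI subset_UNIV)
    fix a
    assume "a \<in> UNIV - {a. Re (\<Omega> a a) \<le> 1}"
    then have Q: "1 < Re (\<Omega> a a)" (is "1 < ?Q") by simp
    obtain C where C: "\<And>b. cmod (\<Omega> b a) \<le> C * N b" using bounded by blast
    \<comment> \<open>Within distance \<open>r\<close> of \<open>a\<close> the value of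
      \<open>\<Omega> \<cdot> a\<close> changes by less than \<open>?Q - sqrt ?Q\<close>. The
      constant \<open>C\<close> may be zero or negative, hence the denominator
      \<open>\<bar>C\<bar> + 1\<close>.\<close>
    define r where "r = (?Q - sqrt ?Q) / (\<bar>C\<bar> + 1)"
    have "sqrt ?Q < ?Q"
      using Q by (intro real_less_lsqrt) (auto simp: power2_eq_square)
    then have "0 < r" by (simp add: r_def)
    moreover have "1 < Re (\<Omega> b b)" if b: "N (a - b) < r" for b
    proof -
      have "?Q - cmod (\<Omega> b a) \<le> cmod (\<Omega> a a - \<Omega> b a)"
        using norm_triangle_ineq2[of "\<Omega> a a" "\<Omega> b a"] complex_Re_le_cmod[of "\<Omega> a a"] by linarith
      also have "\<dots> \<le> C * N (a - b)"
        using C[of "a - b"] by (simp add: form_diff_left)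
      also have "\<dots> \<le> (\<bar>C\<bar> + 1) * N (a - b)"
        using M.nonneg[of a b] by (intro mult_right_mono) auto
      also have "\<dots> < (\<bar>C\<bar> + 1) * r"
        using b by (intro mult_strict_left_mono) auto
      also have "\<dots> = ?Q - sqrt ?Q"
        by (simp add: r_def add_nonneg_eq_0_iff)
      finally have "sqrt ?Q < cmod (\<Omega> b a)" by simp
      then have "?Q < (cmod (\<Omega> b a))\<^sup>2"
        using Q power_strict_mono[of "sqrt ?Q" "cmod (\<Omega> b a)" 2] by simp
      also have "\<dots> \<le> Re (\<Omega> b b) * ?Q" by (rule Cauchy_Schwarz)
      finally show ?thesis using Q by simp
    qed
    ultimately show "\<exists>r>0. disjnt {a. Re (\<Omega> a a) \<le> 1} (M.mball a r)"
      by (intro exI[of _ r]) (force simp: disjnt_def)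
  qed
  show "convex {a. Re (\<Omega> a a) \<le> 1}" by (rule unit_ball_convex)
  show "c *\<^sub>C a \<in> {a. Re (\<Omega> a a) \<le> 1}" if "cmod c \<le> 1" "a \<in> {a. Re (\<Omega> a a) \<le> 1}" for c a
  proof -
    have "(cmod c)\<^sup>2 * Re (\<Omega> a a) \<le> 1 * 1"
      using that form_self(2) by (intro mult_mono) (auto simp: abs_square_le_1)
    then show ?thesis by (simp add: Re_form_scale)
  qed
  show "\<exists>r>0. \<forall>c. cmod c \<le> r \<longrightarrow> c *\<^sub>C a \<in> {a. Re (\<Omega> a a) \<le> 1}" for a
  \<comment> \<open>The summand 1 keeps the radius meaningful when
    \<open>\<Omega> a a = 0\<close>.\<close>
  proof (intro exI[of _ "1 / sqrt (Re (\<Omega> a a) + 1)"] conjI allI impI)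
    have Q: "0 < Re (\<Omega> a a) + 1" using form_self(2)[of a] by simp
    then show "0 < 1 / sqrt (Re (\<Omega> a a) + 1)" by simp
    fix c
    assume "cmod c \<le> 1 / sqrt (Re (\<Omega> a a) + 1)"
    then have "(cmod c)\<^sup>2 \<le> (1 / sqrt (Re (\<Omega> a a) + 1))\<^sup>2"
      by (rule power_mono) simp
    then have "(cmod c)\<^sup>2 * Re (\<Omega> a a) \<le> 1 / (Re (\<Omega> a a) + 1) * Re (\<Omega> a a)"
      using form_self(2)[of a] Q by (intro mult_right_mono) (auto simp: power_divide)
    also have "\<dots> \<le> 1" using Q by simp
    finally show "c *\<^sub>C a \<in> {a. Re (\<Omega> a a) \<le> 1}" by (simp add: Re_form_scale)
  qed
qed

text \<open>Turns separate into joint continuity: the unit ball of the form is a barrel, hence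
  contains a norm ball around 0. Scaling into that ball bounds \<open>\<Omega> a a\<close>, and
  Cauchy-Schwarz carries the bound over to \<open>\<Omega> a b\<close>.\<close>

lemma barrelled_bounded:
  assumes N: "complex_norm N" and bounded: "\<And>b. \<exists>C. \<forall>a. cmod (\<Omega> a b) \<le> C * N a"
    and "barrelled N"
  obtains K where "0 < K" "\<And>a b. cmod (\<Omega> a b) \<le> K * (N a * N b)"
proof -
  interpret N: complex_norm N by (rule N)
  interpret M: Metric_space UNIV "norm_dist N" by (rule N.Metric_space_norm_dist)
  have Npos: "0 \<le> N a" for a using M.nonneg[of a 0] by simp
  have "barrel N {a. Re (\<Omega> a a) \<le> 1}" by (rule unit_ball_barrel[OF N bounded])
  with \<open>barrelled N\<close> have "0 \<in> norm_topology N interior_of {a. Re (\<Omega> a a) \<le> 1}"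
    by (simp add: barrelled_def)
  then obtain U where U: "openin (norm_topology N) U" "0 \<in> U" "U \<subseteq> {a. Re (\<Omega> a a) \<le> 1}"
    by (auto simp: interior_of_def)
  from U(1,2) obtain r where r0: "0 < r" "M.mball 0 r \<subseteq> U"
    unfolding M.openin_mtopology by metis
  then have r: "0 < r" "M.mball 0 r \<subseteq> {a. Re (\<Omega> a a) \<le> 1}"
    using U(3) by auto
  have N0: "N (- a) = N a" for a using N.norm_scale[of "-1" a] by simp
  have ball: "Re (\<Omega> a a) \<le> 1" if "N a < r" for a
    using r(2) that by (auto simp: subset_iff N0)
  \<comment> \<open>A nonzero \<open>a\<close> is rescaled to norm \<open>r / 2\<close>, strictly
    inside the ball of radius \<open>r\<close>; undoing the scaling costs the factor
    \<open>(2 / r)\<^sup>2\<close>.\<close>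
  define K where "K = (2 / r)\<^sup>2"
  have "0 < K" using r(1) by (simp add: K_def)
  have Q: "Re (\<Omega> a a) \<le> K * (N a)\<^sup>2" for a
  proof (cases "a = 0")
    case True
    then show ?thesis using N.norm_eq_zero_iff[of 0] by simp
  next
    case False
    then have pos: "0 < N a" using Npos[of a] N.norm_eq_zero_iff[of a] by linarith
    define c where "c = r / (2 * N a)"
    have c: "0 < c" using r(1) pos by (simp add: c_def)
    have "N (complex_of_real c *\<^sub>C a) < r"
      using r(1) pos c by (simp add: N.norm_scale) (simp add: c_def)
    then have "c\<^sup>2 * Re (\<Omega> a a) \<le> 1"
      using ball[of "complex_of_real c *\<^sub>C a"] c by (simp add: Re_form_scale)
    then have "Re (\<Omega> a a) \<le> 1 / c\<^sup>2" using c by (simp add: field_simps)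
    also have "\<dots> = K * (N a)\<^sup>2"
      using r(1) pos by (simp add: c_def K_def field_simps)
    finally show ?thesis .
  qed
  show ?thesis
  proof (rule that[OF \<open>0 < K\<close>])
    fix a b
    have "(cmod (\<Omega> a b))\<^sup>2 \<le> (K * (N a)\<^sup>2) * (K * (N b)\<^sup>2)"
      using Q form_self(2) \<open>0 < K\<close>
      by (intro order_trans[OF Cauchy_Schwarz mult_mono]) auto
    also have "\<dots> = (K * (N a * N b))\<^sup>2" by (simp add: power2_eq_square)
    finally show "cmod (\<Omega> a b) \<le> K * (N a * N b)"
      by (rule power2_le_imp_le) (use \<open>0 < K\<close> Npos in simp)
  qed
qed

lemma positive_form_scale:
  assumes "0 \<le> r"
  shows "positive_form (\<lambda>a b. complex_of_real r * \<Omega> a b)"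
proof
  show "sesquilinear (\<lambda>a b. complex_of_real r * \<Omega> a b)"
    by (simp add: sesquilinear_def form_simps algebra_simps)
  show "0 \<le> complex_of_real r * \<Omega> a a" for a
    using assms nonneg[of a] by (simp add: less_eq_complex_def)
qed

end

lemma invariant_formsD:
  assumes "\<Omega> \<in> invariant_forms A\<^sub>0 mul star N"
  shows "positive_form \<Omega>"
    and "\<lbrakk>x \<in> A\<^sub>0; y \<in> A\<^sub>0\<rbrakk> \<Longrightarrow> \<Omega> (mul a x) y = \<Omega> x (mul (star a) y)"
    and "cmod (\<Omega> a b) \<le> N a * N b"
  using assms by (auto simp: invariant_forms_def positive_form_def)

section \<open>Linear maps and forms on the tensor product\<close>

lemma tensor_zero_left [simp]: "0 \<otimes> b = 0"
  using tensor_scale_left[of 0 0 b] by simp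

lemma tensor_zero_right [simp]: "a \<otimes> 0 = 0"
  using tensor_scale_right[of a 0 0] by simp

lemma tensor_sum_right: "a \<otimes> sum f I = (\<Sum>i\<in>I. a \<otimes> f i)"
  by (induction I rule: infinite_finite_induct) (simp_all add: tensor_add_right)

lemma tensor_sum_left: "sum f I \<otimes> b = (\<Sum>i\<in>I. f i \<otimes> b)"
  by (induction I rule: infinite_finite_induct) (simp_all add: tensor_add_left)

text \<open>The linear map given by the universal property of the tensor product. For bilinear
  \<open>f\<close> the chosen representation of \<open>u\<close> does not matter.\<close>

definition tensor_lift ::
  "('a::complex_vector \<Rightarrow> 'b::complex_vector \<Rightarrow> 'c::complex_vector) \<Rightarrow> ('a, 'b) tensor \<Rightarrow> 'c" where
  "tensor_lift f u = free_sum (\<lambda>(a, b). f a b) (tensor_rep UNIV UNIV u)"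

lemma tensor_lift_abs:
  "cbilinear f \<Longrightarrow> tensor_lift f (abs_tensor p) = free_sum (\<lambda>(a, b). f a b) p"
  unfolding tensor_lift_def by (rule free_sum_eq[OF _ tensor_rep_UNIV])

lemma tensor_lift_tensor: "cbilinear f \<Longrightarrow> tensor_lift f (a \<otimes> b) = f a b"
  by (simp add: tensor.abs_eq tensor_lift_abs)

lemma clinear_tensor_lift:
  assumes "cbilinear f"
  shows "clinear (tensor_lift f)"
proof (rule clinearI)
  show "tensor_lift f (u + v) = tensor_lift f u + tensor_lift f v" for u v
    by (cases u rule: tensor_cases, cases v rule: tensor_cases)
      (simp add: abs_tensor_add tensor_lift_abs[OF assms] free_sum_add)
  show "tensor_lift f (c *\<^sub>C u) = c *\<^sub>C tensor_lift f u" for c u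
    by (cases u rule: tensor_cases)
      (simp add: abs_tensor_scale tensor_lift_abs[OF assms] free_sum_scale)
qed

lemma clinear_sum:
  assumes "clinear f"
  shows "f (sum g I) = (\<Sum>i\<in>I. f (g i))"
proof -
  have "f 0 = 0" using clinear_simps(2)[OF assms, of 0 0] by simp
  then show ?thesis
    by (induction I rule: infinite_finite_induct) (simp_all add: clinear_simps(1)[OF assms])
qed

lemma clinear_tensor_ext:
  assumes "clinear f" "clinear g" "\<And>a b. f (a \<otimes> b) = g (a \<otimes> b)"
  shows "f u = g u"
  by (induction u rule: tensor_induct)
    (simp_all add: assms clinear_simps(1)[OF assms(1)] clinear_simps(1)[OF assms(2)])

text \<open>Each second component is written in terms of \<open>S\<close> and its scalars are moved
  to the left, so that every element of \<open>S\<close> collects one vector coefficient from the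
  first space.\<close>

lemma tensor_basis_expansion:
  fixes u :: "('a::complex_vector, 'b::complex_vector) tensor"
  assumes "complex_vector.span S = (UNIV :: 'b set)"
  shows "\<exists>F f. finite F \<and> F \<subseteq> S \<and> u = (\<Sum>b\<in>F. f b \<otimes> b)"
proof (induction u rule: tensor_induct)
  case (tensor a b)
  have "b \<in> complex_vector.span S" using assms by simp
  then obtain F c where "finite F" "F \<subseteq> S" "b = (\<Sum>s\<in>F. c s *\<^sub>C s)"
    unfolding complex_vector.span_explicit by blast
  then have "a \<otimes> b = (\<Sum>s\<in>F. (c s *\<^sub>C a) \<otimes> s)"
    by (simp add: tensor_sum_right tensor_scale_left tensor_scale_right)
  then show ?case using \<open>finite F\<close> \<open>F \<subseteq> S\<close>
    by (intro exI[of _ F] exI[of _ "\<lambda>s. c s *\<^sub>C a"] conjI)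
next
  case (add u v)
  then obtain F f G g where F: "finite F" "F \<subseteq> S" "u = (\<Sum>b\<in>F. f b \<otimes> b)"
    and G: "finite G" "G \<subseteq> S" "v = (\<Sum>b\<in>G. g b \<otimes> b)" by blast
  \<comment> \<open>Both coefficient families are extended by 0 to the common index set
    \<open>F \<union> G\<close>.\<close>
  define h where "h b = (if b \<in> F then f b else 0) + (if b \<in> G then g b else 0)" for b
  have "u = (\<Sum>b\<in>F \<union> G. (if b \<in> F then f b else 0) \<otimes> b)"
    unfolding F(3) using F(1) G(1) by (intro sum.mono_neutral_cong_left) auto
  moreover have "v = (\<Sum>b\<in>F \<union> G. (if b \<in> G then g b else 0) \<otimes> b)"
    unfolding G(3) using F(1) G(1) by (intro sum.mono_neutral_cong_left) auto
  ultimately have "u + v = (\<Sum>b\<in>F \<union> G. h b \<otimes> b)"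
    by (simp add: h_def tensor_add_left sum.distrib)
  then show ?case using F G by (intro exI[of _ "F \<union> G"] exI[of _ h]) simp
qed

text \<open>The inner conjugation makes the function of \<open>a\<close> and \<open>b\<close> bilinear; the outer one undoes it.\<close>

definition tensor_form ::
  "('a::complex_vector \<Rightarrow> 'a \<Rightarrow> complex) \<Rightarrow> ('b::complex_vector \<Rightarrow> 'b \<Rightarrow> complex) \<Rightarrow>
   ('a, 'b) tensor \<Rightarrow> ('a, 'b) tensor \<Rightarrow> complex" where
  "tensor_form \<Omega>\<^sub>1 \<Omega>\<^sub>2 u v =
     cnj (tensor_lift (\<lambda>a b. cnj (tensor_lift (\<lambda>x y. \<Omega>\<^sub>1 x a * \<Omega>\<^sub>2 y b) u)) v)"

context
  fixes \<Omega>\<^sub>1 :: "'a::complex_vector \<Rightarrow> 'a \<Rightarrow> complex" and \<Omega>\<^sub>2 :: "'b::complex_vector \<Rightarrow> 'b \<Rightarrow> complex"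
  assumes sesq1: "sesquilinear \<Omega>\<^sub>1" and sesq2: "sesquilinear \<Omega>\<^sub>2"
begin

lemmas sesq_simps = sesquilinear_simps[OF sesq1] sesquilinear_simps[OF sesq2]

lemma cbilinear_form: "cbilinear (\<lambda>x y. \<Omega>\<^sub>1 x a * \<Omega>\<^sub>2 y b)"
  by (auto simp: cbilinear_def sesq_simps algebra_simps intro!: clinearI)

lemmas lift_form_simps = clinear_simps[OF clinear_tensor_lift[OF cbilinear_form]]

lemma lift_form_sesquilinear:
  "tensor_lift (\<lambda>x y. \<Omega>\<^sub>1 x (a + a') * \<Omega>\<^sub>2 y b) u =
    tensor_lift (\<lambda>x y. \<Omega>\<^sub>1 x a * \<Omega>\<^sub>2 y b) u + tensor_lift (\<lambda>x y. \<Omega>\<^sub>1 x a' * \<Omega>\<^sub>2 y b) u"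
  "tensor_lift (\<lambda>x y. \<Omega>\<^sub>1 x a * \<Omega>\<^sub>2 y (b + b')) u =
    tensor_lift (\<lambda>x y. \<Omega>\<^sub>1 x a * \<Omega>\<^sub>2 y b) u + tensor_lift (\<lambda>x y. \<Omega>\<^sub>1 x a * \<Omega>\<^sub>2 y b') u"
  "tensor_lift (\<lambda>x y. \<Omega>\<^sub>1 x (c *\<^sub>C a) * \<Omega>\<^sub>2 y b) u = cnj c * tensor_lift (\<lambda>x y. \<Omega>\<^sub>1 x a * \<Omega>\<^sub>2 y b) u"
  "tensor_lift (\<lambda>x y. \<Omega>\<^sub>1 x a * \<Omega>\<^sub>2 y (c *\<^sub>C b)) u = cnj c * tensor_lift (\<lambda>x y. \<Omega>\<^sub>1 x a * \<Omega>\<^sub>2 y b) u"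
  by (induction u rule: tensor_induct)
    (simp_all add: lift_form_simps(1) tensor_lift_tensor[OF cbilinear_form], simp_all add: sesq_simps algebra_simps)

lemma cbilinear_form_cnj:
  "cbilinear (\<lambda>a b. cnj (tensor_lift (\<lambda>x y. \<Omega>\<^sub>1 x a * \<Omega>\<^sub>2 y b) u))"
  by (auto simp: cbilinear_def lift_form_sesquilinear intro!: clinearI)

lemma tensor_form_tensor_right:
  "tensor_form \<Omega>\<^sub>1 \<Omega>\<^sub>2 u (a \<otimes> b) = tensor_lift (\<lambda>x y. \<Omega>\<^sub>1 x a * \<Omega>\<^sub>2 y b) u"
  by (simp add: tensor_form_def tensor_lift_tensor[OF cbilinear_form_cnj])

lemma tensor_form_tensor: "tensor_form \<Omega>\<^sub>1 \<Omega>\<^sub>2 (x \<otimes> y) (a \<otimes> b) = \<Omega>\<^sub>1 x a * \<Omega>\<^sub>2 y b"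
  by (simp add: tensor_form_tensor_right tensor_lift_tensor[OF cbilinear_form])

text \<open>Conjugate linearity on the right comes from the outer lift. Linearity on the left is
  that of the inner lift when the right argument is elementary, and passes to sums because the form
  is additive on the right.\<close>

lemma sesquilinear_tensor_form: "sesquilinear (tensor_form \<Omega>\<^sub>1 \<Omega>\<^sub>2)"
proof -
  note right = clinear_simps[OF clinear_tensor_lift[OF cbilinear_form_cnj]]
  have add: "tensor_form \<Omega>\<^sub>1 \<Omega>\<^sub>2 u (v + w) = tensor_form \<Omega>\<^sub>1 \<Omega>\<^sub>2 u v + tensor_form \<Omega>\<^sub>1 \<Omega>\<^sub>2 u w" for u v w
    by (simp add: tensor_form_def right)
  moreover have "tensor_form \<Omega>\<^sub>1 \<Omega>\<^sub>2 u (c *\<^sub>C v) = cnj c * tensor_form \<Omega>\<^sub>1 \<Omega>\<^sub>2 u v" for c u v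
    by (simp add: tensor_form_def right)
  moreover have "tensor_form \<Omega>\<^sub>1 \<Omega>\<^sub>2 (u + u') v = tensor_form \<Omega>\<^sub>1 \<Omega>\<^sub>2 u v + tensor_form \<Omega>\<^sub>1 \<Omega>\<^sub>2 u' v" for u u' v
    by (induction v rule: tensor_induct) (simp_all add: tensor_form_tensor_right lift_form_simps add)
  moreover have "tensor_form \<Omega>\<^sub>1 \<Omega>\<^sub>2 (c *\<^sub>C u) v = c * tensor_form \<Omega>\<^sub>1 \<Omega>\<^sub>2 u v" for c u v
    by (induction v rule: tensor_induct)
      (simp_all add: tensor_form_tensor_right lift_form_simps add algebra_simps)
  ultimately show ?thesis unfolding sesquilinear_def by blast
qed

end

section \<open>Positivity and invariance of the tensor product of two forms\<close>

text \<open>Gram-Schmidt on the first components, one elementary tensor at a time: the part of a new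
  first component along an earlier \<open>a i\<close> is split off and absorbed into the second
  component belonging to \<open>a i\<close>. Null vectors of \<open>\<Omega>\<close> may occur among
  the \<open>a i\<close>.\<close>

lemma (in positive_form) orthogonal_expansion:
  fixes u :: "('a, 'b::complex_vector) tensor"
  shows "\<exists>(k::nat) a b. u = (\<Sum>i<k. a i \<otimes> b i) \<and> (\<forall>i<k. \<forall>j<k. i \<noteq> j \<longrightarrow> \<Omega> (a i) (a j) = 0)"
proof -
  obtain p where "u = abs_tensor p" by (rule tensor_cases)
  then have u: "u = (\<Sum>(x, y)\<in>Poly_Mapping.keys p. (Poly_Mapping.lookup p (x, y) *\<^sub>C x) \<otimes> y)"
    by (simp add: abs_tensor_free_sum free_sum_def tensor_scale_left case_prod_unfold)
  have "\<exists>(k::nat) a b. (\<Sum>(x, y)\<in>I. (Poly_Mapping.lookup p (x, y) *\<^sub>C x) \<otimes> y) = (\<Sum>i<k. a i \<otimes> b i)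
      \<and> (\<forall>i<k. \<forall>j<k. i \<noteq> j \<longrightarrow> \<Omega> (a i) (a j) = 0)" if "finite I" for I
    using that
  proof (induction I)
    case empty
    show ?case by (intro exI[of _ 0]) simp
  next
    case (insert z I)
    obtain x y where z: "z = (x, y)" by force
    define v where "v = Poly_Mapping.lookup p (x, y) *\<^sub>C x"
    obtain k :: nat and a b where
      I: "(\<Sum>(x, y)\<in>I. (Poly_Mapping.lookup p (x, y) *\<^sub>C x) \<otimes> y) = (\<Sum>i<k. a i \<otimes> b i)"
      and orth: "\<And>i j. \<lbrakk>i < k; j < k; i \<noteq> j\<rbrakk> \<Longrightarrow> \<Omega> (a i) (a j) = 0"
      using insert.IH by blast
    \<comment> \<open>Gram-Schmidt; the quotient is \<open>0/0 = 0\<close> if \<open>\<Omega> (a i) (a i) = 0\<close>, by Cauchy-Schwarz.\<close>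
    define c where "c i = \<Omega> v (a i) / \<Omega> (a i) (a i)" for i
    define v' where "v' = v - (\<Sum>i<k. c i *\<^sub>C a i)"
    have v': "\<Omega> v' (a j) = 0" if j: "j < k" for j
    proof -
      have "(\<Sum>i<k. c i * \<Omega> (a i) (a j)) = (\<Sum>i<k. if i = j then c j * \<Omega> (a j) (a j) else 0)"
        by (rule sum.cong) (use orth j in auto)
      also have "\<dots> = c j * \<Omega> (a j) (a j)" using j by simp
      also have "\<dots> = \<Omega> v (a j)"
        using null_left[of "a j" v] hermitian[of v "a j"] by (cases "\<Omega> (a j) (a j) = 0") (auto simp: c_def)
      finally show ?thesis
        by (simp add: v'_def form_diff_left form_sum_left form_simps)
    qed
    then have v'': "\<Omega> (a j) v' = 0" if "j < k" for j
      using that hermitian[of "a j" v'] by simp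
    have "(\<Sum>(x, y)\<in>insert z I. (Poly_Mapping.lookup p (x, y) *\<^sub>C x) \<otimes> y) = v \<otimes> y + (\<Sum>i<k. a i \<otimes> b i)"
      using insert I by (simp add: z v_def)
    also have "v = v' + (\<Sum>i<k. c i *\<^sub>C a i)" by (simp add: v'_def)
    also have "(v' + (\<Sum>i<k. c i *\<^sub>C a i)) \<otimes> y = v' \<otimes> y + (\<Sum>i<k. a i \<otimes> (c i *\<^sub>C y))"
      by (simp add: tensor_add_left tensor_scale_right tensor_sum_left tensor_scale_left)
    also have "v' \<otimes> y + (\<Sum>i<k. a i \<otimes> (c i *\<^sub>C y)) + (\<Sum>i<k. a i \<otimes> b i) =
        (\<Sum>i<k. a i \<otimes> (b i + c i *\<^sub>C y)) + v' \<otimes> y"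
      by (simp add: tensor_add_right sum.distrib)
    also have "\<dots> = (\<Sum>i<Suc k. (a(k := v')) i \<otimes> (if i < k then b i + c i *\<^sub>C y else y))"
      by simp
    finally show ?case
      by (intro exI[of _ "Suc k"] exI[of _ "a(k := v')"] exI conjI, assumption)
        (use orth v' v'' in \<open>auto simp: less_Suc_eq\<close>)
  qed
  from this[of "Poly_Mapping.keys p"] show ?thesis unfolding u by simp
qed

text \<open>For an expansion with \<open>\<Omega>\<^sub>1\<close>-orthogonal first components the
  double sum collapses to its diagonal, whose terms are products of nonnegative numbers.\<close>

lemma positive_tensor_form:
  fixes \<Omega>\<^sub>1 :: "'a::complex_vector \<Rightarrow> 'a \<Rightarrow> complex" and \<Omega>\<^sub>2 :: "'b::complex_vector \<Rightarrow> 'b \<Rightarrow> complex"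
  assumes "positive_form \<Omega>\<^sub>1" "positive_form \<Omega>\<^sub>2"
  shows "positive_form (tensor_form \<Omega>\<^sub>1 \<Omega>\<^sub>2)"
proof
  interpret P1: positive_form \<Omega>\<^sub>1 by fact
  interpret P2: positive_form \<Omega>\<^sub>2 by fact
  show sesq: "sesquilinear (tensor_form \<Omega>\<^sub>1 \<Omega>\<^sub>2)"
    by (rule sesquilinear_tensor_form[OF P1.sesq P2.sesq])
  note simps = sesquilinear_simps[OF sesq]
  have zero: "tensor_form \<Omega>\<^sub>1 \<Omega>\<^sub>2 0 v = 0" "tensor_form \<Omega>\<^sub>1 \<Omega>\<^sub>2 v 0 = 0" for v
    using simps(3)[of 0 0 v] simps(4)[of v 0 0] by simp_all
  have sum: "tensor_form \<Omega>\<^sub>1 \<Omega>\<^sub>2 (sum f I) v = (\<Sum>i\<in>I. tensor_form \<Omega>\<^sub>1 \<Omega>\<^sub>2 (f i) v)"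
    "tensor_form \<Omega>\<^sub>1 \<Omega>\<^sub>2 v (sum f I) = (\<Sum>i\<in>I. tensor_form \<Omega>\<^sub>1 \<Omega>\<^sub>2 v (f i))" for f :: "nat \<Rightarrow> _" and I v
    by (induction I rule: infinite_finite_induct) (simp_all add: simps zero)
  fix u :: "('a, 'b) tensor"
  obtain k :: nat and a b where u: "u = (\<Sum>i<k. a i \<otimes> b i)"
    and orth: "\<And>i j. \<lbrakk>i < k; j < k; i \<noteq> j\<rbrakk> \<Longrightarrow> \<Omega>\<^sub>1 (a i) (a j) = 0"
    using P1.orthogonal_expansion[of u] by blast
  have "tensor_form \<Omega>\<^sub>1 \<Omega>\<^sub>2 u u = (\<Sum>i<k. \<Sum>j<k. \<Omega>\<^sub>1 (a i) (a j) * \<Omega>\<^sub>2 (b i) (b j))"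
    unfolding u sum tensor_form_tensor[OF P1.sesq P2.sesq] by (rule sum.swap)
  also have "\<dots> = (\<Sum>i<k. \<Sum>j<k. if j = i then \<Omega>\<^sub>1 (a i) (a i) * \<Omega>\<^sub>2 (b i) (b i) else 0)"
    by (intro sum.cong) (use orth in auto)
  also have "\<dots> = (\<Sum>i<k. \<Omega>\<^sub>1 (a i) (a i) * \<Omega>\<^sub>2 (b i) (b i))" by simp
  also have "0 \<le> \<dots>"
    by (intro sum_nonneg mult_nonneg_nonneg P1.nonneg P2.nonneg)
  finally show "0 \<le> tensor_form \<Omega>\<^sub>1 \<Omega>\<^sub>2 u u" .
qed

text \<open>Both sides are additive in \<open>x\<close>, \<open>y\<close> and \<open>u\<close>, so
  three nested inductions reduce the identity to elementary tensors, where it is the product of the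
  invariance identities of the factors.\<close>

lemma tensor_form_invariant:
  assumes A: "quasi_star_algebra A\<^sub>0 multA starA" and B: "quasi_star_algebra B\<^sub>0 multB starB"
    and \<Omega>\<^sub>1: "\<Omega>\<^sub>1 \<in> invariant_forms A\<^sub>0 multA starA NA" and \<Omega>\<^sub>2: "\<Omega>\<^sub>2 \<in> invariant_forms B\<^sub>0 multB starB NB"
    and x: "x \<in> tensor_subspace A\<^sub>0 B\<^sub>0" and y: "y \<in> tensor_subspace A\<^sub>0 B\<^sub>0"
  shows "tensor_form \<Omega>\<^sub>1 \<Omega>\<^sub>2 (tensor_mult A\<^sub>0 multA B\<^sub>0 multB u x) y =
    tensor_form \<Omega>\<^sub>1 \<Omega>\<^sub>2 x (tensor_mult A\<^sub>0 multA B\<^sub>0 multB (tensor_star starA starB u) y)"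
proof -
  interpret A: quasi_star_algebra A\<^sub>0 multA starA by (rule A)
  interpret P1: positive_form \<Omega>\<^sub>1 by (rule invariant_formsD(1)[OF \<Omega>\<^sub>1])
  interpret P2: positive_form \<Omega>\<^sub>2 by (rule invariant_formsD(1)[OF \<Omega>\<^sub>2])
  interpret P: positive_form "tensor_form \<Omega>\<^sub>1 \<Omega>\<^sub>2"
    by (rule positive_tensor_form) unfold_locales
  interpret AB: quasi_star_algebra "tensor_subspace A\<^sub>0 B\<^sub>0" "tensor_mult A\<^sub>0 multA B\<^sub>0 multB"
    "tensor_star starA starB"
    by (rule tensor_quasi_star_algebra[OF A B])
  note lin = P.form_simps tensor_mult_bilinear[OF A B] AB.star_add
  note zero = tensor_zero[OF A B]
  show ?thesis
    using x A.subspace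
  proof (induction rule: tensor_subspace_induct)
    case x: (tensor a b)
    show ?case
      using y A.subspace
    proof (induction rule: tensor_subspace_induct)
      case y: (tensor a' b')
      show ?case
        by (induction u rule: tensor_induct)
          (use x y in \<open>simp_all add: lin tensor_mult_tensor_right[OF A B] tensor_star_tensor[OF A B]
            tensor_form_tensor[OF P1.sesq P2.sesq] tensor_subspace_tensor
            invariant_formsD(2)[OF \<Omega>\<^sub>1] invariant_formsD(2)[OF \<Omega>\<^sub>2]\<close>)
    qed (use x in \<open>simp_all add: lin zero\<close>)
  qed (use y in \<open>simp_all add: lin zero\<close>)
qed

section \<open>Semisimplicity\<close>

text \<open>\<open>e = (e* e)* = e* e = e*\<close>. Selfadjointness lets the embeddings
  \<open>a \<mapsto> a \<otimes> e\<close> respect the involution.\<close>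

lemma (in normed_quasi_star_algebra) unit_selfadjoint:
  "\<exists>e\<in>A\<^sub>0. (\<forall>a. a \<cdot> e = a) \<and> N e = 1 \<and> star e = e"
proof -
  obtain e where e: "e \<in> A\<^sub>0" "\<forall>a. a \<cdot> e = a \<and> e \<cdot> a = a" "N e = 1"
    using unit by (elim bexE conjE)
  have "star e = e"
    using star_mult1[OF e(1), of "star e"] e(2) by (simp add: star_star)
  with e show ?thesis by (intro bexI[of _ e]) simp_all
qed

section \<open>From the factors to the tensor product\<close>

text \<open>For \<open>v = a \<otimes> b\<close>, the tensor product of the two rank-one operators
  sends \<open>u\<close> to the multiple of \<open>e \<otimes> e'\<close> by the value of the form
  at \<open>(u, v)\<close>. Since \<open>e \<otimes> e'\<close> has norm 1, boundedness of that
  operator is the claim. The constant depends on \<open>v\<close>; for sums of elementary tensors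
  the constants add up.\<close>

lemma bounded_tensor_form_right:
  assumes A: "normed_quasi_star_algebra A\<^sub>0 multA starA NA"
    and B: "normed_quasi_star_algebra B\<^sub>0 multB starB NB"
    and n: "uniform_cross_norm NA NB n"
    and \<Omega>\<^sub>1: "\<Omega>\<^sub>1 \<in> invariant_forms A\<^sub>0 multA starA NA" and \<Omega>\<^sub>2: "\<Omega>\<^sub>2 \<in> invariant_forms B\<^sub>0 multB starB NB"
  shows "\<exists>C. \<forall>u. cmod (tensor_form \<Omega>\<^sub>1 \<Omega>\<^sub>2 u v) \<le> C * n u"
proof -
  interpret A: normed_quasi_star_algebra A\<^sub>0 multA starA NA by (rule A)
  interpret B: normed_quasi_star_algebra B\<^sub>0 multB starB NB by (rule B)
  interpret n: complex_norm n using n by (simp add: uniform_cross_norm_def cross_norm_def)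
  interpret P1: positive_form \<Omega>\<^sub>1 by (rule invariant_formsD(1)[OF \<Omega>\<^sub>1])
  interpret P2: positive_form \<Omega>\<^sub>2 by (rule invariant_formsD(1)[OF \<Omega>\<^sub>2])
  interpret P: positive_form "tensor_form \<Omega>\<^sub>1 \<Omega>\<^sub>2"
    by (rule positive_tensor_form) unfold_locales
  obtain e where e: "NA e = 1" using A.unit_selfadjoint by metis
  obtain e' where e': "NB e' = 1" using B.unit_selfadjoint by metis
  show ?thesis
  proof (induction v rule: tensor_induct)
    case (tensor a b)
    let ?S = "\<lambda>x. \<Omega>\<^sub>1 x a *\<^sub>C e" and ?T = "\<lambda>y. \<Omega>\<^sub>2 y b *\<^sub>C e'"
    have lin: "clinear ?S" "clinear ?T"
      by (auto intro!: clinearI simp: P1.form_simps P2.form_simps scaleC_add_left)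
    have "NA (?S x) \<le> NA a * NA x" for x
      using invariant_formsD(3)[OF \<Omega>\<^sub>1, of x a] by (simp add: A.norm_scale e mult.commute)
    moreover have "NB (?T y) \<le> NB b * NB y" for y
      using invariant_formsD(3)[OF \<Omega>\<^sub>2, of y b] by (simp add: B.norm_scale e' mult.commute)
    ultimately have "bounded_operator NA ?S" "bounded_operator NB ?T"
      unfolding bounded_operator_def using lin by blast+
    then have "bounded_operator n (tensor_map ?S ?T)"
      using n unfolding uniform_cross_norm_def by blast
    then obtain C where C: "\<And>u. n (tensor_map ?S ?T u) \<le> C * n u"
      unfolding bounded_operator_def by blast
    have "tensor_map ?S ?T u = tensor_form \<Omega>\<^sub>1 \<Omega>\<^sub>2 u (a \<otimes> b) *\<^sub>C (e \<otimes> e')" for u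
      by (rule clinear_tensor_ext[OF clinear_tensor_map[OF lin]])
        (auto intro!: clinearI simp: P.form_simps scaleC_add_left tensor_map_tensor[OF lin]
          tensor_form_tensor[OF P1.sesq P2.sesq] tensor_scale_left tensor_scale_right mult.commute)
    moreover have "n (e \<otimes> e') = 1"
      using n e e' by (simp add: uniform_cross_norm_def cross_norm_def)
    ultimately show ?case
      using C by (intro exI[of _ C]) (simp add: n.norm_scale)
  next
    case (add v w)
    then obtain C D where CD: "\<And>u. cmod (tensor_form \<Omega>\<^sub>1 \<Omega>\<^sub>2 u v) \<le> C * n u"
      "\<And>u. cmod (tensor_form \<Omega>\<^sub>1 \<Omega>\<^sub>2 u w) \<le> D * n u" by blast
    have "cmod (tensor_form \<Omega>\<^sub>1 \<Omega>\<^sub>2 u (v + w)) \<le> (C + D) * n u" for u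
      using norm_triangle_le[OF add_mono[OF CD(1)[of u] CD(2)[of u]]]
      by (simp add: P.form_simps algebra_simps)
    then show ?case by blast
  qed
qed

text \<open>A product form that is positive at \<open>u\<close> is found by algebra and
  Cauchy-Schwarz alone; barrelledness then enters to bound this form jointly, so that it can be
  scaled into an invariant form.\<close>

lemma star_semisimple_tensor:
  fixes A\<^sub>0 :: "'a::complex_vector set" and B\<^sub>0 :: "'b::complex_vector set"
  assumes A: "normed_quasi_star_algebra A\<^sub>0 multA starA NA"
    and B: "normed_quasi_star_algebra B\<^sub>0 multB starB NB"
    and n: "uniform_cross_norm NA NB n" and barrelled: "barrelled n"
    and ssA: "star_semisimple A\<^sub>0 multA starA NA" and ssB: "star_semisimple B\<^sub>0 multB starB NB"
  shows "star_semisimple (tensor_subspace A\<^sub>0 B\<^sub>0) (tensor_mult A\<^sub>0 multA B\<^sub>0 multB)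
    (tensor_star starA starB) n"
  unfolding star_semisimple_def
proof (intro allI impI)
  fix u :: "('a, 'b) tensor"
  assume "u \<noteq> 0"
  interpret A: normed_quasi_star_algebra A\<^sub>0 multA starA NA by (rule A)
  interpret B: normed_quasi_star_algebra B\<^sub>0 multB starB NB by (rule B)
  have norm: "complex_norm n" using n by (simp add: uniform_cross_norm_def cross_norm_def)
  have "\<exists>\<Omega>\<^sub>1\<in>invariant_forms A\<^sub>0 multA starA NA. \<exists>\<Omega>\<^sub>2\<in>invariant_forms B\<^sub>0 multB starB NB.
      0 < tensor_form \<Omega>\<^sub>1 \<Omega>\<^sub>2 u u"
  proof (rule ccontr)
    assume neg: "\<not> ?thesis"
    \<comment> \<open>\<open>slice \<Omega>\<^sub>1 a\<close> applies the functional
      \<open>\<Omega>\<^sub>1 \<cdot> a\<close> to the first factor and keeps the second.\<close>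
    define slice where "slice \<Omega>\<^sub>1 a = tensor_lift (\<lambda>x y. \<Omega>\<^sub>1 x a *\<^sub>C (y::'b))"
      for \<Omega>\<^sub>1 :: "'a \<Rightarrow> 'a \<Rightarrow> complex" and a
    have bil: "cbilinear (\<lambda>x y. \<Omega>\<^sub>1 x a *\<^sub>C (y::'b))" if "\<Omega>\<^sub>1 \<in> invariant_forms A\<^sub>0 multA starA NA" for \<Omega>\<^sub>1 a
    proof -
      interpret positive_form \<Omega>\<^sub>1 by (rule invariant_formsD(1)[OF that])
      show ?thesis
        by (auto simp: cbilinear_def form_simps scaleC_add_left scaleC_add_right mult.commute intro!: clinearI)
    qed
    have slice_zero: "slice \<Omega>\<^sub>1 a u = 0" if \<Omega>\<^sub>1: "\<Omega>\<^sub>1 \<in> invariant_forms A\<^sub>0 multA starA NA" for \<Omega>\<^sub>1 a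
    proof (rule ccontr)
      interpret P1: positive_form \<Omega>\<^sub>1 by (rule invariant_formsD(1)[OF \<Omega>\<^sub>1])
      assume "slice \<Omega>\<^sub>1 a u \<noteq> 0"
      then obtain \<Omega>\<^sub>2 where \<Omega>\<^sub>2: "\<Omega>\<^sub>2 \<in> invariant_forms B\<^sub>0 multB starB NB"
        and pos: "0 < \<Omega>\<^sub>2 (slice \<Omega>\<^sub>1 a u) (slice \<Omega>\<^sub>1 a u)"
        using ssB unfolding star_semisimple_def by blast
      interpret P2: positive_form \<Omega>\<^sub>2 by (rule invariant_formsD(1)[OF \<Omega>\<^sub>2])
      interpret P: positive_form "tensor_form \<Omega>\<^sub>1 \<Omega>\<^sub>2"
        by (rule positive_tensor_form) unfold_locales
      note slice_simps = clinear_simps[OF clinear_tensor_lift[OF bil[OF \<Omega>\<^sub>1]]]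
      \<comment> \<open>For \<open>w = u\<close> and \<open>b = slice \<Omega>\<^sub>1 a u\<close>
        the right side is the positive number \<open>pos\<close>, whereas the left side vanishes
        because \<open>u\<close> is a null vector of the product form.\<close>
      have "tensor_form \<Omega>\<^sub>1 \<Omega>\<^sub>2 w (a \<otimes> b) = \<Omega>\<^sub>2 (slice \<Omega>\<^sub>1 a w) b" for w b
        by (induction w rule: tensor_induct)
          (simp_all add: slice_def tensor_form_tensor[OF P1.sesq P2.sesq]
            tensor_lift_tensor[OF bil[OF \<Omega>\<^sub>1]] slice_simps P.form_simps P2.form_simps)
      moreover have "tensor_form \<Omega>\<^sub>1 \<Omega>\<^sub>2 u u = 0"
        using neg \<Omega>\<^sub>1 \<Omega>\<^sub>2 P.nonneg[of u] by (metis order_le_imp_less_or_eq)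
      ultimately show False
        using P.null_left pos by (metis less_irrefl)
    qed
    obtain S :: "'b set" where S: "complex_vector.independent S" "complex_vector.span S = UNIV"
      using complex_vector.maximal_independent_subset[of UNIV] by (metis top.extremum_uniqueI)
    obtain F f where F: "finite F" "F \<subseteq> S" and u: "u = (\<Sum>b\<in>F. f b \<otimes> b)"
      using tensor_basis_expansion[OF S(2)] by blast
    have "f b = 0" if b: "b \<in> F" for b
    proof (rule ccontr)
      assume "f b \<noteq> 0"
      then obtain \<Omega>\<^sub>1 where \<Omega>\<^sub>1: "\<Omega>\<^sub>1 \<in> invariant_forms A\<^sub>0 multA starA NA" and pos: "0 < \<Omega>\<^sub>1 (f b) (f b)"
        using ssA unfolding star_semisimple_def by blast
      \<comment> \<open>Slicing along \<open>f b\<close> itself gives a vanishing combination of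
        independent vectors whose coefficient at \<open>b\<close> is
        \<open>\<Omega>\<^sub>1 (f b) (f b)\<close>.\<close>
      have "(\<Sum>s\<in>F. \<Omega>\<^sub>1 (f s) (f b) *\<^sub>C s) = slice \<Omega>\<^sub>1 (f b) u"
        by (simp add: u slice_def clinear_sum[OF clinear_tensor_lift[OF bil[OF \<Omega>\<^sub>1]]]
            tensor_lift_tensor[OF bil[OF \<Omega>\<^sub>1]])
      also have "\<dots> = 0" by (rule slice_zero[OF \<Omega>\<^sub>1])
      finally have "\<Omega>\<^sub>1 (f b) (f b) = 0"
        using complex_vector.independentD[OF S(1) F _ b, of "\<lambda>s. \<Omega>\<^sub>1 (f s) (f b)"] by blast
      then show False using pos by simp
    qed
    then show False using u \<open>u \<noteq> 0\<close> by simp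
  qed
  then obtain \<Omega>\<^sub>1 \<Omega>\<^sub>2 where \<Omega>\<^sub>1: "\<Omega>\<^sub>1 \<in> invariant_forms A\<^sub>0 multA starA NA"
    and \<Omega>\<^sub>2: "\<Omega>\<^sub>2 \<in> invariant_forms B\<^sub>0 multB starB NB" and pos: "0 < tensor_form \<Omega>\<^sub>1 \<Omega>\<^sub>2 u u"
    by blast
  interpret P: positive_form "tensor_form \<Omega>\<^sub>1 \<Omega>\<^sub>2"
    by (rule positive_tensor_form[OF invariant_formsD(1)[OF \<Omega>\<^sub>1] invariant_formsD(1)[OF \<Omega>\<^sub>2]])
  obtain K where K: "0 < K" "\<And>v w. cmod (tensor_form \<Omega>\<^sub>1 \<Omega>\<^sub>2 v w) \<le> K * (n v * n w)"
    using P.barrelled_bounded[OF norm bounded_tensor_form_right[OF A B n \<Omega>\<^sub>1 \<Omega>\<^sub>2] barrelled] by blast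
  \<comment> \<open>Invariant forms must be bounded with constant 1, so the form is divided by
    \<open>K\<close>; this preserves its positivity at \<open>u\<close>.\<close>
  let ?\<Omega> = "\<lambda>v w. complex_of_real (1 / K) * tensor_form \<Omega>\<^sub>1 \<Omega>\<^sub>2 v w"
  interpret P': positive_form ?\<Omega>
    by (rule P.positive_form_scale) (use K in simp)
  have "cmod (?\<Omega> v w) \<le> n v * n w" for v w
    using K(1) K(2)[of v w] by (simp add: norm_mult norm_divide field_simps)
  then have "?\<Omega> \<in> invariant_forms (tensor_subspace A\<^sub>0 B\<^sub>0) (tensor_mult A\<^sub>0 multA B\<^sub>0 multB)
      (tensor_star starA starB) n"
    unfolding invariant_forms_def
    using P'.sesq P'.nonneg
      tensor_form_invariant[OF A.quasi_star_algebra_axioms B.quasi_star_algebra_axioms \<Omega>\<^sub>1 \<Omega>\<^sub>2]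
    by simp
  moreover have "0 < ?\<Omega> u u"
    using pos K(1) by (simp add: less_complex_def)
  ultimately show "\<exists>\<Omega>\<in>invariant_forms (tensor_subspace A\<^sub>0 B\<^sub>0) (tensor_mult A\<^sub>0 multA B\<^sub>0 multB)
      (tensor_star starA starB) n. 0 < \<Omega> u u"
    by (intro bexI[of _ ?\<Omega>])
qed

section \<open>From the tensor product to the factors\<close>

text \<open>An invariant form composed with \<open>j\<close> in both arguments is again invariant,
  with the same bound because \<open>j\<close> is isometric. For \<open>a \<noteq> 0\<close> the
  form is chosen positive at \<open>j a\<close>, which is nonzero by injectivity.\<close>

lemma star_semisimple_pullback:
  fixes j :: "'a::complex_vector \<Rightarrow> 'c::complex_vector"
  assumes ss: "star_semisimple C\<^sub>0 multC starC NC" and lin: "clinear j"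
    and norm: "\<And>a. NC (j a) = NA a" and inj: "\<And>a. j a = 0 \<Longrightarrow> a = 0"
    and closed: "\<And>x. x \<in> A\<^sub>0 \<Longrightarrow> j x \<in> C\<^sub>0" and star: "\<And>a. j (starA a) = starC (j a)"
    and mult: "\<And>a x. x \<in> A\<^sub>0 \<Longrightarrow> j (multA a x) = multC (j a) (j x)"
  shows "star_semisimple A\<^sub>0 multA starA NA"
  unfolding star_semisimple_def
proof (intro allI impI)
  fix a :: 'a
  assume "a \<noteq> 0"
  then obtain \<Omega> where \<Omega>: "\<Omega> \<in> invariant_forms C\<^sub>0 multC starC NC" and pos: "0 < \<Omega> (j a) (j a)"
    using ss inj unfolding star_semisimple_def by blast
  interpret positive_form \<Omega> by (rule invariant_formsD(1)[OF \<Omega>])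
  have "(\<lambda>a b. \<Omega> (j a) (j b)) \<in> invariant_forms A\<^sub>0 multA starA NA"
    using nonneg invariant_formsD(3)[OF \<Omega>, of "j _" "j _"]
    by (simp add: invariant_forms_def sesquilinear_def clinear_simps[OF lin] form_simps norm mult star
        closed invariant_formsD(2)[OF \<Omega>])
  then show "\<exists>\<Omega>\<in>invariant_forms A\<^sub>0 multA starA NA. 0 < \<Omega> a a"
    using pos by (intro bexI)
qed

text \<open>The pullback runs along \<open>a \<mapsto> a \<otimes> e'\<close> and
  \<open>b \<mapsto> e \<otimes> b\<close>. The first respects products since
  \<open>(a \<otimes> e')(x \<otimes> e') = ax \<otimes> e'\<close>, respects the involution since
  \<open>e'\<close> is selfadjoint, and is isometric by the cross-norm property; the second is
  symmetric.\<close>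

lemma star_semisimple_factors:
  fixes A\<^sub>0 :: "'a::complex_vector set" and B\<^sub>0 :: "'b::complex_vector set"
  assumes A: "normed_quasi_star_algebra A\<^sub>0 multA starA NA"
    and B: "normed_quasi_star_algebra B\<^sub>0 multB starB NB"
    and n: "cross_norm NA NB n"
    and ss: "star_semisimple (tensor_subspace A\<^sub>0 B\<^sub>0) (tensor_mult A\<^sub>0 multA B\<^sub>0 multB)
      (tensor_star starA starB) n"
  shows "star_semisimple A\<^sub>0 multA starA NA" "star_semisimple B\<^sub>0 multB starB NB"
proof -
  interpret A: normed_quasi_star_algebra A\<^sub>0 multA starA NA by (rule A)
  interpret B: normed_quasi_star_algebra B\<^sub>0 multB starB NB by (rule B)
  interpret n: complex_norm n using n by (simp add: cross_norm_def)
  note qA = A.quasi_star_algebra_axioms and qB = B.quasi_star_algebra_axioms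
  have cross: "n (a \<otimes> b) = NA a * NB b" for a b using n by (simp add: cross_norm_def)
  obtain e where e: "e \<in> A\<^sub>0" "\<And>a. multA a e = a" "NA e = 1" "starA e = e"
    using A.unit_selfadjoint by metis
  obtain e' where e': "e' \<in> B\<^sub>0" "\<And>b. multB b e' = b" "NB e' = 1" "starB e' = e'"
    using B.unit_selfadjoint by metis
  show "star_semisimple A\<^sub>0 multA starA NA"
  proof (rule star_semisimple_pullback[OF ss, where j = "\<lambda>a. a \<otimes> e'"])
    show "a = 0" if "a \<otimes> e' = 0" for a :: 'a
      using cross[of a e'] that e'(3) n.norm_eq_zero_iff[of 0] A.norm_eq_zero_iff[of a] by simp
  qed (use e' in \<open>auto intro!: clinearI simp: tensor_bilinear cross tensor_subspace_tensor
      tensor_star_tensor[OF qA qB] tensor_mult_tensor_right[OF qA qB]\<close>)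
  show "star_semisimple B\<^sub>0 multB starB NB"
  proof (rule star_semisimple_pullback[OF ss, where j = "\<lambda>b. e \<otimes> b"])
    show "b = 0" if "e \<otimes> b = 0" for b :: 'b
      using cross[of e b] that e(3) n.norm_eq_zero_iff[of 0] B.norm_eq_zero_iff[of b] by simp
  qed (use e in \<open>auto intro!: clinearI simp: tensor_bilinear cross tensor_subspace_tensor
      tensor_star_tensor[OF qA qB] tensor_mult_tensor_right[OF qA qB]\<close>)
qed

theorem theorem6p11:
  fixes A\<^sub>0 :: "'a::complex_vector set" and B\<^sub>0 :: "'b::complex_vector set"
    and multA :: "'a \<Rightarrow> 'a \<Rightarrow> 'a" and multB :: "'b \<Rightarrow> 'b \<Rightarrow> 'b"
    and starA :: "'a \<Rightarrow> 'a" and starB :: "'b \<Rightarrow> 'b"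
    and NA :: "'a \<Rightarrow> real" and NB :: "'b \<Rightarrow> real"
    and n :: "('a, 'b) tensor \<Rightarrow> real"
  assumes "banach_quasi_star_algebra A\<^sub>0 multA starA NA"
    and "banach_quasi_star_algebra B\<^sub>0 multB starB NB"
    and "uniform_cross_norm NA NB n"
    and "\<forall>u. n (tensor_star starA starB u) = n u"
  shows "(star_semisimple (tensor_subspace A\<^sub>0 B\<^sub>0) (tensor_mult A\<^sub>0 multA B\<^sub>0 multB)
             (tensor_star starA starB) n \<longrightarrow>
           star_semisimple A\<^sub>0 multA starA NA \<and> star_semisimple B\<^sub>0 multB starB NB) \<and>
         (barrelled n \<longrightarrow>
           star_semisimple A\<^sub>0 multA starA NA \<and> star_semisimple B\<^sub>0 multB starB NB \<longrightarrow>
           star_semisimple (tensor_subspace A\<^sub>0 B\<^sub>0) (tensor_mult A\<^sub>0 multA B\<^sub>0 multB)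
             (tensor_star starA starB) n)"
proof -
  have A: "normed_quasi_star_algebra A\<^sub>0 multA starA NA" and B: "normed_quasi_star_algebra B\<^sub>0 multB starB NB"
    using assms(1,2) by (simp_all add: banach_quasi_star_algebra_def)
  have "cross_norm NA NB n" using assms(3) by (simp add: uniform_cross_norm_def)
  then show ?thesis
    using star_semisimple_factors[OF A B] star_semisimple_tensor[OF A B assms(3)] by blast
qed

end
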